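(* Let $\{E_\lambda:\lambda\in\Lambda\}$ be a family of real Banach spaces, and let $E=[\bigoplus_{\lambda\in\Lambda}E_\lambda]_F$ where $F=c_0$ or $F=l_1$. Then $E$ is a local-GL-space if and only if $E_\lambda$ is a local-GL-space for every $\lambda\in\Lambda$.
   Context: All spaces are over the real field. $B_E$, $S_E$, $E^*$ denote the closed unit ball, the unit sphere and the dual of $E$. $[\bigoplus_{\lambda\in\Lambda}E_\lambda]_{c_0}$ and $[\bigoplus_{\lambda\in\Lambda}E_\lambda]_{l_1}$ denote the $c_0$-sum (families $(x_\lambda)$ with $(\|x_\lambda\|)\in c_0(\Lambda)$, norm $\sup_\lambda\|x_\lambda\|$) and the $l_1$-sum (families with $(\|x_\lambda\|)\in l_1(\Lambda)$, norm $\sum_\lambda\|x_\lambda\|$). A Banach space $E$ is a GL-space (generalized-lush space) if for every $x\in S_E$ and every $\varepsilon>0$ there is $x^*\in S_{E^*}$ such that, with $S=S(x^*,\varepsilon)=\{z\in B_E: x^*(z)>1-\varepsilon\}$, one has $x\in S$ and $\mathrm{dist}(y,S)+\mathrm{dist}(y,-S)<2+\varepsilon$ for all $y\in S_E$. A Banach space $E$ is a local-GL-space if for every separable subspace $X\subset E$ there is a (closed) subspace $Y$ of $E$ which is a GL-space (with the inherited norm) and satisfies $X\subset Y\subset E$. *)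

theory Defs
  imports "HOL-Analysis.Analysis" "HOL-Library.Function_Algebras"
begin

text \<open>
  A normed space is a pair of a linear subspace \<open>V\<close> of some ambient real vector space and a norm
  \<open>N\<close> on \<open>V\<close>. The ambient space only supplies the linear operations: it carries no norm, and
  values of \<open>N\<close> outside \<open>V\<close> are irrelevant. In this way the members of a family of spaces over a
  common ambient type can be entirely unrelated to one another, since any family of real vector
  spaces embeds linearly into its algebraic direct sum.
\<close>

definition normed_space_on :: "'a::real_vector set \<Rightarrow> ('a \<Rightarrow> real) \<Rightarrow> bool" where
  "normed_space_on V N \<longleftrightarrow>
     subspace V \<and>
     (\<forall>x\<in>V. 0 \<le> N x) \<and>
     (\<forall>x\<in>V. N x = 0 \<longleftrightarrow> x = 0) \<and>
     (\<forall>c. \<forall>x\<in>V. N (c *\<^sub>R x) = \<bar>c\<bar> * N x) \<and>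
     (\<forall>x\<in>V. \<forall>y\<in>V. N (x + y) \<le> N x + N y)"

text \<open>
  The value 0 off \<open>V\<close> is needed because the locale \<^locale>\<open>Metric_space\<close> requires symmetry and
  nonnegativity on the whole type.
\<close>

definition norm_dist :: "'a::real_vector set \<Rightarrow> ('a \<Rightarrow> real) \<Rightarrow> 'a \<Rightarrow> 'a \<Rightarrow> real" where
  "norm_dist V N x y = (if x \<in> V \<and> y \<in> V then N (x - y) else 0)"

lemma Metric_space_norm_dist:
  assumes "normed_space_on V N"
  shows "Metric_space V (norm_dist V N)"
proof
  have sub: "subspace V" and nonneg: "\<And>x. x \<in> V \<Longrightarrow> 0 \<le> N x"
    and zero: "\<And>x. x \<in> V \<Longrightarrow> N x = 0 \<longleftrightarrow> x = 0"
    and scale: "\<And>c x. x \<in> V \<Longrightarrow> N (c *\<^sub>R x) = \<bar>c\<bar> * N x"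
    and tri: "\<And>x y. x \<in> V \<Longrightarrow> y \<in> V \<Longrightarrow> N (x + y) \<le> N x + N y"
    using assms unfolding normed_space_on_def by auto
  show "0 \<le> norm_dist V N x y" for x y
    using nonneg subspace_diff[OF sub] by (simp add: norm_dist_def)
  show "norm_dist V N x y = norm_dist V N y x" for x y
    using scale[of "x - y" "-1"] subspace_diff[OF sub, of x y] by (auto simp: norm_dist_def)
  show "norm_dist V N x y = 0 \<longleftrightarrow> x = y" if "x \<in> V" "y \<in> V" for x y
    using that zero subspace_diff[OF sub] by (simp add: norm_dist_def)
  show "norm_dist V N x z \<le> norm_dist V N x y + norm_dist V N y z"
    if "x \<in> V" "y \<in> V" "z \<in> V" for x y z
    using that tri[of "x - y" "y - z"] subspace_diff[OF sub] by (simp add: norm_dist_def)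
qed

definition norm_topology :: "'a::real_vector set \<Rightarrow> ('a \<Rightarrow> real) \<Rightarrow> 'a topology" where
  "norm_topology V N = Metric_space.mtopology V (norm_dist V N)"

definition banach_space_on :: "'a::real_vector set \<Rightarrow> ('a \<Rightarrow> real) \<Rightarrow> bool" where
  "banach_space_on V N \<longleftrightarrow>
     normed_space_on V N \<and> Metric_space.mcomplete V (norm_dist V N)"

definition unit_ball_on :: "'a::real_vector set \<Rightarrow> ('a \<Rightarrow> real) \<Rightarrow> 'a set" where
  "unit_ball_on V N = {x \<in> V. N x \<le> 1}"

definition unit_sphere_on :: "'a::real_vector set \<Rightarrow> ('a \<Rightarrow> real) \<Rightarrow> 'a set" where
  "unit_sphere_on V N = {x \<in> V. N x = 1}"

text \<open>
  Functionals are functions on the ambient type of which only the restriction to \<open>V\<close> matters;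
  they are not required to be linear outside \<open>V\<close>.
\<close>

definition dual_on :: "'a::real_vector set \<Rightarrow> ('a \<Rightarrow> real) \<Rightarrow> ('a \<Rightarrow> real) set" where
  "dual_on V N =
     {f. (\<forall>x\<in>V. \<forall>y\<in>V. f (x + y) = f x + f y) \<and>
         (\<forall>c. \<forall>x\<in>V. f (c *\<^sub>R x) = c * f x) \<and>
         (\<exists>K. \<forall>x\<in>V. \<bar>f x\<bar> \<le> K * N x)}"

definition dual_norm_on :: "'a::real_vector set \<Rightarrow> ('a \<Rightarrow> real) \<Rightarrow> ('a \<Rightarrow> real) \<Rightarrow> real" where
  "dual_norm_on V N f = (SUP x\<in>unit_ball_on V N. \<bar>f x\<bar>)"

definition dual_sphere_on :: "'a::real_vector set \<Rightarrow> ('a \<Rightarrow> real) \<Rightarrow> ('a \<Rightarrow> real) set" where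
  "dual_sphere_on V N = {f \<in> dual_on V N. dual_norm_on V N f = 1}"

definition slice_on ::
  "'a::real_vector set \<Rightarrow> ('a \<Rightarrow> real) \<Rightarrow> ('a \<Rightarrow> real) \<Rightarrow> real \<Rightarrow> 'a set" where
  "slice_on V N f \<epsilon> = {z \<in> unit_ball_on V N. f z > 1 - \<epsilon>}"

definition dist_to_set :: "('a::real_vector \<Rightarrow> real) \<Rightarrow> 'a \<Rightarrow> 'a set \<Rightarrow> real" where
  "dist_to_set N y S = (INF z\<in>S. N (y - z))"

text \<open>
  In the next definition the conjunct \<open>x \<in> S\<close> makes the slice nonempty, so both infima are taken
  over nonempty sets.
\<close>

definition GL_space :: "'a::real_vector set \<Rightarrow> ('a \<Rightarrow> real) \<Rightarrow> bool" where
  "GL_space V N \<longleftrightarrow>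
     banach_space_on V N \<and>
     (\<forall>x\<in>unit_sphere_on V N. \<forall>\<epsilon>>0. \<exists>f\<in>dual_sphere_on V N.
        let S = slice_on V N f \<epsilon> in
          x \<in> S \<and>
          (\<forall>y\<in>unit_sphere_on V N.
             dist_to_set N y S + dist_to_set N y (uminus ` S) < 2 + \<epsilon>))"

definition local_GL_space :: "'a::real_vector set \<Rightarrow> ('a \<Rightarrow> real) \<Rightarrow> bool" where
  "local_GL_space V N \<longleftrightarrow>
     banach_space_on V N \<and>
     (\<forall>X. subspace X \<and> X \<subseteq> V \<and> separable_space (norm_topology X N) \<longrightarrow>
        (\<exists>Y. X \<subseteq> Y \<and> Y \<subseteq> V \<and> subspace Y \<and> closedin (norm_topology V N) Y \<and>
             GL_space Y N))"

instantiation "fun" :: (type, real_vector) real_vector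
begin

definition scaleR_fun :: "real \<Rightarrow> ('a \<Rightarrow> 'b) \<Rightarrow> 'a \<Rightarrow> 'b" where
  "scaleR_fun c f = (\<lambda>x. c *\<^sub>R f x)"

instance
  by standard (simp_all add: scaleR_fun_def fun_eq_iff scaleR_add_right scaleR_add_left)

end

lemma scaleR_fun_apply [simp]: "(c *\<^sub>R f) x = c *\<^sub>R f x"
  by (simp add: scaleR_fun_def)

text \<open>
  Families indexed by \<open>\<Lambda>\<close> are represented by functions that vanish outside \<open>\<Lambda>\<close>, so that equality
  of families is equality of functions.
\<close>

definition family_space :: "'i set \<Rightarrow> ('i \<Rightarrow> 'a::real_vector set) \<Rightarrow> ('i \<Rightarrow> 'a) set" where
  "family_space \<Lambda> V = {x. (\<forall>i\<in>\<Lambda>. x i \<in> V i) \<and> (\<forall>i. i \<notin> \<Lambda> \<longrightarrow> x i = 0)}"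

definition c0_sum ::
  "'i set \<Rightarrow> ('i \<Rightarrow> 'a::real_vector set) \<Rightarrow> ('i \<Rightarrow> 'a \<Rightarrow> real) \<Rightarrow> ('i \<Rightarrow> 'a) set" where
  "c0_sum \<Lambda> V N = {x \<in> family_space \<Lambda> V. \<forall>\<epsilon>>0. finite {i \<in> \<Lambda>. N i (x i) \<ge> \<epsilon>}}"

text \<open>
  Inserting 0 does not change a supremum of norms unless \<open>\<Lambda>\<close> is empty, where it gives the norm of
  the zero space instead of the unspecified value of \<^term>\<open>Sup {} :: real\<close>.
\<close>

definition c0_norm :: "'i set \<Rightarrow> ('i \<Rightarrow> 'a::real_vector \<Rightarrow> real) \<Rightarrow> ('i \<Rightarrow> 'a) \<Rightarrow> real" where
  "c0_norm \<Lambda> N x = Sup (insert 0 ((\<lambda>i. N i (x i)) ` \<Lambda>))"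

definition l1_sum ::
  "'i set \<Rightarrow> ('i \<Rightarrow> 'a::real_vector set) \<Rightarrow> ('i \<Rightarrow> 'a \<Rightarrow> real) \<Rightarrow> ('i \<Rightarrow> 'a) set" where
  "l1_sum \<Lambda> V N = {x \<in> family_space \<Lambda> V. (\<lambda>i. N i (x i)) summable_on \<Lambda>}"

definition l1_norm :: "'i set \<Rightarrow> ('i \<Rightarrow> 'a::real_vector \<Rightarrow> real) \<Rightarrow> ('i \<Rightarrow> 'a) \<Rightarrow> real" where
  "l1_norm \<Lambda> N x = infsum (\<lambda>i. N i (x i)) \<Lambda>"

end

theory Submission
  imports Defs
begin

text \<open>
  For a Banach space, being a local-GL-space is equivalent to a condition on the norm alone
  (\<open>metric_GL\<close> below): for unit vectors \<open>x, y\<close> there are \<open>z, w\<close> in the unit ball with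
  \<open>\<parallel>x + z + w\<parallel>\<close> close to 3 and \<open>\<parallel>y - z\<parallel> + \<parallel>y + w\<parallel>\<close> not much larger than 2. The functional
  defining a slice through \<open>x\<close> has disappeared: some norm-one functional is almost 1 at \<open>x\<close>, \<open>z\<close>
  and \<open>w\<close> exactly when the norm of the sum is almost 3. A closing-off argument puts every separable
  subspace into a separable closed one with the same property. In a separable space, applying the
  condition successively to the members \<open>y\<^sub>n\<close> of a dense sequence, each time with \<open>x\<close> replaced by
  the normalized sum obtained in the step before, yields by Hahn-Banach a single functional that
  works for all \<open>y\<^sub>n\<close>. Passing the metric condition between a sum and its summands is then a
  computation with norms.
\<close>

section \<open>Sublinear functionals\<close>

text \<open>Two obstacles shape the proof. A GL-subspace obtained from the local property of a sum
  need not itself be a sum of subspaces of the summands; a condition on pairs of vectors avoids any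
  such decomposition. Further, \<open>metric_GL\<close> lets \<open>z\<close> and \<open>w\<close>
  vary with \<open>y\<close>, whereas a slice must serve all \<open>y\<close> at once. For countably
  many \<open>y\<close> the gap is bridged backwards: with \<open>u (Suc n)\<close> the normalized
  sum \<open>u n + z n + w n\<close>, a functional of norm at most 1 that nearly attains 1 at
  \<open>u (Suc n)\<close> does so at \<open>u n\<close>, \<open>z n\<close> and \<open>w n\<close>,
  the error growing at most by the factor 4. Tolerances \<delta> / 4^n therefore keep all errors
  below \<delta>. Since the requirement at a later index implies those at earlier ones, the
  requirements form an increasing union of cones, each compatible with the norm, and one Hahn-Banach
  argument meets them all.\<close>

definition sublinear :: "('a::real_vector \<Rightarrow> real) \<Rightarrow> bool" where
  "sublinear p \<longleftrightarrow> (\<forall>x y. p (x + y) \<le> p x + p y) \<and> (\<forall>t\<ge>0. \<forall>x. p (t *\<^sub>R x) = t * p x)"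

lemma sublinearD:
  assumes "sublinear p"
  shows "p (x + y) \<le> p x + p y" "t \<ge> 0 \<Longrightarrow> p (t *\<^sub>R x) = t * p x" "p 0 = 0" "- p (- x) \<le> p x"
proof -
  show add: "p (x + y) \<le> p x + p y" for x y
    using assms by (simp add: sublinear_def)
  show scale: "t \<ge> 0 \<Longrightarrow> p (t *\<^sub>R x) = t * p x" for t x
    using assms by (simp add: sublinear_def)
  show "p 0 = 0"
    using scale[of 0 x] by simp
  then show "- p (- x) \<le> p x"
    using add[of x "- x"] by simp
qed

text \<open>Serves three infima: the directional one that makes a minimal functional odd, the lower
  bound of a chain, and the functional encoding a cone of constraints. An inclusion under scaling is
  enough, because the reverse inequality comes from the inverse scalar.\<close>

lemma sublinear_Inf:
  fixes A :: "'a::real_vector \<Rightarrow> real set"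
  assumes ne: "\<And>v. A v \<noteq> {}"
    and bdd: "\<And>v. bdd_below (A v)"
    and add: "\<And>v w a b. a \<in> A v \<Longrightarrow> b \<in> A w \<Longrightarrow> \<exists>c\<in>A (v + w). c \<le> a + b"
    and scale: "\<And>v a t. t > 0 \<Longrightarrow> a \<in> A v \<Longrightarrow> t * a \<in> A (t *\<^sub>R v)"
  shows "sublinear (\<lambda>v. Inf (A v))"
proof -
  have le: "Inf (A v) \<le> a" if "a \<in> A v" for a v
    using that bdd by (rule cInf_lower)
  have "Inf (A (v + w)) \<le> Inf (A v) + Inf (A w)" for v w
  proof -
    have "Inf (A (v + w)) - a \<le> Inf (A w)" if a: "a \<in> A v" for a
    proof (rule cInf_greatest[OF ne])
      fix b assume "b \<in> A w"
      then obtain c where "c \<in> A (v + w)" "c \<le> a + b"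
        using add a by blast
      then show "Inf (A (v + w)) - a \<le> b"
        using le[of c "v + w"] by simp
    qed
    then have "Inf (A (v + w)) - Inf (A w) \<le> Inf (A v)"
      by (intro cInf_greatest[OF ne]) (simp add: algebra_simps)
    then show ?thesis by simp
  qed
  moreover have scale_le: "Inf (A (t *\<^sub>R v)) \<le> t * Inf (A v)" if "t > 0" for t v
  proof -
    have "Inf (A (t *\<^sub>R v)) / t \<le> Inf (A v)"
    proof (rule cInf_greatest[OF ne])
      fix a assume "a \<in> A v"
      then show "Inf (A (t *\<^sub>R v)) / t \<le> a"
        using le[OF scale[OF that]] that by (simp add: divide_le_eq mult.commute)
    qed
    then show ?thesis
      using that by (simp add: divide_le_eq mult.commute)
  qed
  moreover have pos: "Inf (A (t *\<^sub>R v)) = t * Inf (A v)" if "t > 0" for t v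
  proof (rule antisym[OF scale_le[OF that]])
    show "t * Inf (A v) \<le> Inf (A (t *\<^sub>R v))"
      using scale_le[of "inverse t" "t *\<^sub>R v"] that by (simp add: field_simps)
  qed
  \<comment> \<open>Homogeneity at scalar 0 is forced: scaling 0 by 2 gives
    \<open>Inf (A 0) = 2 * Inf (A 0)\<close>.\<close>
  moreover have "Inf (A 0) = 0"
    using pos[of 2 0] by simp
  ultimately show ?thesis
    unfolding sublinear_def by (metis less_eq_real_def mult_zero_left scaleR_zero_left)
qed

text \<open>
  For sublinear \<open>q\<close> and fixed \<open>v\<close>, the infimum over \<open>t \<ge> 0\<close> of \<open>q (x + t v) - t q v\<close> is again
  sublinear in \<open>x\<close>, lies below \<open>q\<close>, and is at most \<open>- q v\<close> at \<open>- v\<close>; so minimality makes \<open>q\<close> odd.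
\<close>

lemma minimal_sublinear_linear:
  assumes q: "sublinear q"
    and minimal: "\<And>r. sublinear r \<Longrightarrow> (\<And>v. r v \<le> q v) \<Longrightarrow> r = q"
  shows "linear q"
proof -
  note D = sublinearD[OF q]
  have neg: "q (- v) = - q v" for v
  proof -
    define A where "A = (\<lambda>x. {q (x + t *\<^sub>R v) - t * q v |t. t \<ge> 0})"
    \<comment> \<open>A bound free of \<open>t\<close>; without it the infimum would be an
      unspecified real.\<close>
    have bd: "- q (- x) \<le> a" if "a \<in> A x" for x a
    proof -
      from that obtain t where t: "t \<ge> 0" "a = q (x + t *\<^sub>R v) - t * q v"
        by (auto simp: A_def)
      have "q (t *\<^sub>R v) \<le> q (x + t *\<^sub>R v) + q (- x)"
        using D(1)[of "x + t *\<^sub>R v" "- x"] by simp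
      then show ?thesis
        using D(2)[OF t(1), of v] t by simp
    qed
    have bdd: "bdd_below (A x)" for x
      using bd by (meson bdd_belowI)
    have "sublinear (\<lambda>x. Inf (A x))"
    proof (rule sublinear_Inf)
      show "A x \<noteq> {}" for x
        unfolding A_def by auto
    next
      fix x y a b assume "a \<in> A x" "b \<in> A y"
      then obtain s t where st: "s \<ge> 0" "t \<ge> 0" "a = q (x + s *\<^sub>R v) - s * q v"
          "b = q (y + t *\<^sub>R v) - t * q v"
        unfolding A_def by auto
      have "q (x + y + (s + t) *\<^sub>R v) - (s + t) * q v \<in> A (x + y)"
        using st unfolding A_def by (auto intro!: exI[of _ "s + t"])
      moreover have "q (x + y + (s + t) *\<^sub>R v) - (s + t) * q v \<le> a + b"
        using D(1)[of "x + s *\<^sub>R v" "y + t *\<^sub>R v"] st by (simp add: algebra_simps)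
      ultimately show "\<exists>c\<in>A (x + y). c \<le> a + b" by blast
    next
      fix x a t assume t: "(t::real) > 0" and "a \<in> A x"
      then obtain s where s: "s \<ge> 0" "a = q (x + s *\<^sub>R v) - s * q v"
        unfolding A_def by auto
      have "t * a = q (t *\<^sub>R x + (t * s) *\<^sub>R v) - (t * s) * q v"
        using D(2)[of t "x + s *\<^sub>R v"] t s by (simp add: scaleR_add_right right_diff_distrib mult.assoc)
      then show "t * a \<in> A (t *\<^sub>R x)"
        using t s unfolding A_def by (auto intro!: exI[of _ "t * s"])
    qed (rule bdd)
    moreover have "Inf (A x) \<le> q x" for x
      by (rule cInf_lower[OF _ bdd]) (auto simp: A_def intro!: exI[of _ 0])
    ultimately have "q (- v) = Inf (A (- v))"
      using minimal[of "\<lambda>x. Inf (A x)"] by metis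
    also have "\<dots> \<le> - q v"
      by (rule cInf_lower[OF _ bdd]) (auto simp: A_def D(3) intro!: exI[of _ 1])
    finally show ?thesis
      using D(4)[of v] by simp
  qed
  show ?thesis
  proof
    fix x y
    show "q (x + y) = q x + q y"
      using D(1)[of x y] D(1)[of "x + y" "- y"] neg[of y] by simp
  next
    fix c x
    show "q (c *\<^sub>R x) = c *\<^sub>R q x"
    proof (cases "c \<ge> 0")
      case True
      then show ?thesis using D(2) by simp
    next
      case False
      then show ?thesis using D(2)[of "- c" x] neg[of "c *\<^sub>R x"] by simp
    qed
  qed
qed

text \<open>Zorn's lemma on the sublinear functionals below \<open>p\<close>: a chain is bounded
  below by its pointwise infimum, and a minimal element is linear. There is no partial functional to
  extend; constraints enter through the choice of \<open>p\<close>.\<close>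

theorem Hahn_Banach_sublinear:
  fixes p :: "'a::real_vector \<Rightarrow> real"
  assumes p: "sublinear p"
  obtains f where "linear f" "\<And>v. f v \<le> p v"
proof -
  define A where "A = {q. sublinear q \<and> q \<le> p}"
  \<comment> \<open>The order is reversed, so the maximal element that Zorn provides is a minimal
    functional.\<close>
  have "\<exists>m\<in>A. \<forall>a\<in>A. m \<ge> a \<longrightarrow> a = m"
  proof (rule predicate_Zorn)
    show "partial_order_on A (relation_of (\<ge>) A)"
      by (rule partial_order_on_relation_ofI) auto
  next
    fix C assume C: "C \<in> Chains (relation_of (\<ge>) A)"
    then have CA: "C \<subseteq> A" by (rule Chains_relation_of)
    show "\<exists>u\<in>A. \<forall>a\<in>C. a \<ge> u"
    proof (cases "C = {}")
      case True
      then show ?thesis using p by (auto simp: A_def)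
    next
      case False
      have lower: "- p (- v) \<le> q v" if "q \<in> C" for q v
      proof -
        have "sublinear q" "q (- v) \<le> p (- v)"
          using CA that by (auto simp: A_def le_fun_def)
        then show ?thesis using sublinearD(4)[of q v] by linarith
      qed
      have bdd: "bdd_below ((\<lambda>q. q v) ` C)" for v
        using lower by (auto intro!: bdd_belowI)
      define u where "u = (\<lambda>v. Inf ((\<lambda>q. q v) ` C))"
      have "sublinear u"
        unfolding u_def
      proof (rule sublinear_Inf[OF _ bdd])
        show "(\<lambda>q. q v) ` C \<noteq> {}" for v using False by simp
      next
        fix v w a b
        assume "a \<in> (\<lambda>q. q v) ` C" "b \<in> (\<lambda>q. q w) ` C"
        then obtain q r where qr: "q \<in> C" "r \<in> C" "a = q v" "b = r w" by blast
        have "q \<le> r \<or> r \<le> q"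
          using C qr by (auto simp: Chains_def relation_of_def)
        then obtain s where s: "s \<in> C" "s \<le> q" "s \<le> r"
          using qr by blast
        then have "s (v + w) \<le> a + b"
          using CA sublinearD(1)[of s v w] qr by (force simp: A_def le_fun_def intro: order_trans add_mono)
        then show "\<exists>c\<in>(\<lambda>q. q (v + w)) ` C. c \<le> a + b"
          using s by blast
      next
        fix v a t assume "(t::real) > 0" "a \<in> (\<lambda>q. q v) ` C"
        then show "t * a \<in> (\<lambda>q. q (t *\<^sub>R v)) ` C"
          using CA by (auto simp: A_def sublinearD(2) intro!: rev_image_eqI)
      qed
      moreover have below: "u \<le> q" if "q \<in> C" for q
        unfolding u_def le_fun_def using that by (auto intro!: cInf_lower bdd)
      moreover have "u \<le> p"
      proof -
        obtain q where "q \<in> C" using False by blast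
        then show ?thesis using below CA by (force simp: A_def)
      qed
      ultimately show ?thesis
        by (auto simp: A_def)
    qed
  qed
  then obtain m where m: "sublinear m" "m \<le> p" and min: "\<And>a. sublinear a \<Longrightarrow> a \<le> p \<Longrightarrow> a \<le> m \<Longrightarrow> a = m"
    by (auto simp: A_def)
  have "linear m"
    by (rule minimal_sublinear_linear[OF m(1)]) (metis le_funI min m(2) order_trans)
  then show ?thesis
    using that m(2) by (auto simp: le_fun_def)
qed

section \<open>Normed subspaces\<close>

locale normed_on =
  fixes V :: "'a::real_vector set" and N :: "'a \<Rightarrow> real"
  assumes normed: "normed_space_on V N"
begin

lemma carrier_subspace: "subspace V"
  and norm_ge_0: "x \<in> V \<Longrightarrow> 0 \<le> N x"
  and norm_eq_0_iff: "x \<in> V \<Longrightarrow> N x = 0 \<longleftrightarrow> x = 0"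
  and norm_scale: "x \<in> V \<Longrightarrow> N (c *\<^sub>R x) = \<bar>c\<bar> * N x"
  and norm_triangle: "x \<in> V \<Longrightarrow> y \<in> V \<Longrightarrow> N (x + y) \<le> N x + N y"
  using normed by (auto simp: normed_space_on_def)

lemma mem [simp, intro]: "0 \<in> V" "x \<in> V \<Longrightarrow> y \<in> V \<Longrightarrow> x + y \<in> V"
  "x \<in> V \<Longrightarrow> y \<in> V \<Longrightarrow> x - y \<in> V" "x \<in> V \<Longrightarrow> - x \<in> V" "x \<in> V \<Longrightarrow> c *\<^sub>R x \<in> V"
  using carrier_subspace by (auto intro: subspace_0 subspace_add subspace_diff subspace_neg subspace_scale)

lemma norm_0 [simp]: "N 0 = 0"
  using norm_eq_0_iff by simp

lemma norm_minus: "x \<in> V \<Longrightarrow> N (- x) = N x"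
  using norm_scale[of x "-1"] by simp

lemma norm_minus_commute: "x \<in> V \<Longrightarrow> y \<in> V \<Longrightarrow> N (x - y) = N (y - x)"
  using norm_minus[of "x - y"] by simp

lemma norm_diff_triangle: "x \<in> V \<Longrightarrow> y \<in> V \<Longrightarrow> N (x - y) \<le> N x + N y"
  using norm_triangle[of x "- y"] norm_minus[of y] by simp

lemma norm_triangle_sub: "x \<in> V \<Longrightarrow> y \<in> V \<Longrightarrow> N x - N y \<le> N (x - y)"
  using norm_triangle[of "x - y" y] by simp

lemma norm_triangle_add: "x \<in> V \<Longrightarrow> y \<in> V \<Longrightarrow> N x - N y \<le> N (x + y)"
  using norm_triangle_sub[of x "- y"] norm_minus[of y] by simp

lemma norm_pos: "x \<in> V \<Longrightarrow> x \<noteq> 0 \<Longrightarrow> 0 < N x"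
  using norm_eq_0_iff norm_ge_0 by (metis less_eq_real_def)

lemma norm_normalized:
  assumes "x \<in> V" "x \<noteq> 0"
  shows "N ((1 / N x) *\<^sub>R x) = 1"
  using norm_scale[OF assms(1), of "1 / N x"] norm_pos[OF assms] by simp

lemma subspace_normed_on: "subspace Y \<Longrightarrow> Y \<subseteq> V \<Longrightarrow> normed_on Y N"
  using normed by unfold_locales (simp add: normed_space_on_def subset_iff)

sublocale Metric_space V "norm_dist V N"
  by (rule Metric_space_norm_dist[OF normed])

lemma mcomplete_iff:
  "mcomplete \<longleftrightarrow> (\<forall>s::nat \<Rightarrow> 'a. (\<forall>n. s n \<in> V) \<longrightarrow> (\<forall>\<epsilon>>0. \<exists>M. \<forall>m\<ge>M. \<forall>n\<ge>M. N (s m - s n) < \<epsilon>) \<longrightarrow>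
     (\<exists>x\<in>V. \<forall>\<epsilon>>0. \<exists>M. \<forall>n\<ge>M. N (s n - x) < \<epsilon>))"
proof -
  have Cauchy: "MCauchy s \<longleftrightarrow> (\<forall>n. s n \<in> V) \<and> (\<forall>\<epsilon>>0. \<exists>M. \<forall>m\<ge>M. \<forall>n\<ge>M. N (s m - s n) < \<epsilon>)" for s
    unfolding MCauchy_def norm_dist_def by (simp add: image_subset_iff) metis
  have limit: "limitin mtopology s x sequentially \<longleftrightarrow> x \<in> V \<and> (\<forall>\<epsilon>>0. \<exists>M. \<forall>n\<ge>M. N (s n - x) < \<epsilon>)"
    if "\<And>n. s n \<in> V" for s x
    unfolding limit_metric_sequentially norm_dist_def using that by (auto cong: conj_cong)
  have *: "(MCauchy s \<longrightarrow> (\<exists>x. limitin mtopology s x sequentially)) \<longleftrightarrow>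
      ((\<forall>n. s n \<in> V) \<longrightarrow> (\<forall>\<epsilon>>0. \<exists>M. \<forall>m\<ge>M. \<forall>n\<ge>M. N (s m - s n) < \<epsilon>) \<longrightarrow>
     (\<exists>x\<in>V. \<forall>\<epsilon>>0. \<exists>M. \<forall>n\<ge>M. N (s n - x) < \<epsilon>))" for s
  proof (cases "\<forall>n. s n \<in> V")
    case True
    then show ?thesis by (simp add: Cauchy limit Bex_def)
  next
    case False
    then show ?thesis by (auto simp: Cauchy)
  qed
  show ?thesis
    unfolding mcomplete_def by (intro all_cong1) (rule *)
qed

lemma closedin_norm_topologyI:
  assumes "Y \<subseteq> V" and "\<And>x. x \<in> V \<Longrightarrow> (\<And>\<epsilon>. \<epsilon> > 0 \<Longrightarrow> \<exists>y\<in>Y. N (x - y) < \<epsilon>) \<Longrightarrow> x \<in> Y"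
  shows "closedin (norm_topology V N) Y"
  unfolding norm_topology_def closedin_metric
proof (intro conjI allI impI)
  fix x assume x: "x \<in> V - Y"
  then obtain \<epsilon> where "\<epsilon> > 0" "\<forall>y\<in>Y. \<not> N (x - y) < \<epsilon>"
    using assms(2) by blast
  then show "\<exists>r>0. disjnt Y (mball x r)"
    using x by (auto simp: disjnt_iff norm_dist_def split: if_splits intro!: exI[of _ \<epsilon>])
qed (rule assms(1))

lemma separable_norm_topology_iff:
  "separable_space (norm_topology V N) \<longleftrightarrow>
     (\<exists>D. countable D \<and> D \<subseteq> V \<and> (\<forall>x\<in>V. \<forall>\<epsilon>>0. \<exists>d\<in>D. N (x - d) < \<epsilon>))"
proof -
  have "mtopology closure_of D = V \<longleftrightarrow> (\<forall>x\<in>V. \<forall>\<epsilon>>0. \<exists>d\<in>D. N (x - d) < \<epsilon>)" if "D \<subseteq> V" for D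
    using that unfolding metric_closure_of by (auto simp: norm_dist_def subset_iff set_eq_iff) metis+
  then show ?thesis
    unfolding separable_space_def norm_topology_def by (simp cong: conj_cong)
qed

text \<open>A pair \<open>(c, s)\<close> of the convex cone \<open>K\<close> is the demand
  \<open>f c \<ge> s\<close>, and \<open>s \<le> N c\<close> is its compatibility with
  \<open>f \<le> N\<close>. All demands are put into the sublinear functional that takes
  \<open>v\<close> to the infimum of \<open>N (v + c) - s\<close>: the pair \<open>(0, 0)\<close>
  yields \<open>f v \<le> N v\<close>, and the argument \<open>v = - c\<close> yields
  \<open>f (- c) \<le> - s\<close>.\<close>

lemma dominated_functional:
  assumes K0: "(0, 0) \<in> K"
    and K: "\<And>c s. (c, s) \<in> K \<Longrightarrow> c \<in> V \<and> s \<le> N c"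
    and add: "\<And>c s d t. (c, s) \<in> K \<Longrightarrow> (d, t) \<in> K \<Longrightarrow> (c + d, s + t) \<in> K"
    and scale: "\<And>c s t. (c, s) \<in> K \<Longrightarrow> t > 0 \<Longrightarrow> (t *\<^sub>R c, t * s) \<in> K"
  obtains f where "linear f" "\<And>v. v \<in> V \<Longrightarrow> f v \<le> N v" "\<And>c s. (c, s) \<in> K \<Longrightarrow> s \<le> f c"
proof -
  \<comment> \<open>\<open>N\<close> is meaningful only on \<open>V\<close>, while Hahn-Banach works
    on the whole type; a linear projection onto \<open>V\<close> mediates.\<close>
  obtain P where P: "range P \<subseteq> V" "linear P" "\<And>v. v \<in> V \<Longrightarrow> P v = v"
    using linear_exists_left_inverse_on[OF linear_id carrier_subspace] by auto
  have PV [simp]: "P v \<in> V" for v using P(1) by blast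
  define A where "A = (\<lambda>v. {N (P v + c) - s |c s. (c, s) \<in> K})"
  have lower: "- N (P v) \<le> a" if "a \<in> A v" for v a
  proof -
    from that obtain c s where cs: "(c, s) \<in> K" "a = N (P v + c) - s"
      by (auto simp: A_def)
    then show ?thesis
      using norm_triangle_add[of c "P v"] K[OF cs(1)] by (simp add: add.commute)
  qed
  have bdd: "bdd_below (A v)" for v
    using lower by (meson bdd_belowI)
  have "sublinear (\<lambda>v. Inf (A v))"
  proof (rule sublinear_Inf[OF _ bdd])
    show "A v \<noteq> {}" for v using K0 by (auto simp: A_def)
  next
    fix v w a b assume "a \<in> A v" "b \<in> A w"
    then obtain c s d t where *: "(c, s) \<in> K" "(d, t) \<in> K" "a = N (P v + c) - s" "b = N (P w + d) - t"
      by (auto simp: A_def)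
    have "N (P (v + w) + (c + d)) \<le> N (P v + c) + N (P w + d)"
      using norm_triangle[of "P v + c" "P w + d"] K * P(2) by (simp add: linear_add algebra_simps)
    moreover have "N (P (v + w) + (c + d)) - (s + t) \<in> A (v + w)"
      using add[OF *(1,2)] by (auto simp: A_def)
    ultimately show "\<exists>e\<in>A (v + w). e \<le> a + b"
      using * by (intro bexI) auto
  next
    fix v a t assume t: "(t::real) > 0" and "a \<in> A v"
    then obtain c s where *: "(c, s) \<in> K" "a = N (P v + c) - s"
      by (auto simp: A_def)
    have "t * a = N (P (t *\<^sub>R v) + t *\<^sub>R c) - t * s"
      using * t K P(2) norm_scale[of "P v + c" t]
      by (simp add: linear_scale scaleR_add_right right_diff_distrib)
    then show "t * a \<in> A (t *\<^sub>R v)"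
      using scale[OF *(1) t] by (auto simp: A_def)
  qed
  then obtain f where f: "linear f" "\<And>v. f v \<le> Inf (A v)"
    using Hahn_Banach_sublinear by blast
  have fle: "f v \<le> a" if "a \<in> A v" for v a
    using f(2)[of v] cInf_lower[OF that bdd] by linarith
  show ?thesis
  proof (rule that[OF f(1)])
    fix v assume "v \<in> V"
    then show "f v \<le> N v"
      using fle[of "N v" v] K0 P(3) by (force simp: A_def)
  next
    fix c s assume cs: "(c, s) \<in> K"
    then have "N (P (- c) + c) - s \<in> A (- c)" by (auto simp: A_def)
    moreover have "N (P (- c) + c) = 0"
      using K[OF cs] P(3) by simp
    ultimately show "s \<le> f c"
      using fle[of "- s" "- c"] f(1) by (simp add: linear_neg)
  qed
qed

end

section \<open>A metric characterization of local-GL-spaces\<close>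

text \<open>Here \<open>z\<close> stands for a point of the slice and \<open>- w\<close> for a point
  of the opposite slice, hence the two signs in the last sum. Both may depend on \<open>y\<close>,
  so a single instance concerns only the pair \<open>x\<close>, \<open>y\<close>.\<close>

definition metric_GL :: "'a::real_vector set \<Rightarrow> ('a \<Rightarrow> real) \<Rightarrow> bool" where
  "metric_GL V N \<longleftrightarrow>
     (\<forall>x\<in>unit_sphere_on V N. \<forall>y\<in>unit_sphere_on V N. \<forall>\<epsilon>>0.
        \<exists>z\<in>unit_ball_on V N. \<exists>w\<in>unit_ball_on V N.
          N (x + z + w) > 3 - \<epsilon> \<and> N (y - z) + N (y + w) < 2 + \<epsilon>)"

lemma metric_GLD:
  assumes "metric_GL V N" "x \<in> V" "N x = 1" "y \<in> V" "N y = 1" "\<epsilon> > 0"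
  obtains z w where "z \<in> V" "N z \<le> 1" "w \<in> V" "N w \<le> 1"
    "N (x + z + w) > 3 - \<epsilon>" "N (y - z) + N (y + w) < 2 + \<epsilon>"
  using assms unfolding metric_GL_def unit_sphere_on_def unit_ball_on_def by blast

section \<open>Slices and norm-one functionals\<close>

context normed_on
begin

lemma dual_norm_upper:
  assumes "f \<in> dual_on V N" "x \<in> V" "N x \<le> 1"
  shows "\<bar>f x\<bar> \<le> dual_norm_on V N f"
proof -
  obtain K where K: "\<forall>x\<in>V. \<bar>f x\<bar> \<le> K * N x"
    using assms(1) by (auto simp: dual_on_def)
  have "\<bar>f v\<bar> \<le> \<bar>K\<bar>" if "v \<in> V" "N v \<le> 1" for v
  proof -
    have "K * N v \<le> \<bar>K\<bar> * 1"
      using that norm_ge_0 by (intro mult_mono) auto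
    then show ?thesis using K that(1) by force
  qed
  then have "bdd_above ((\<lambda>x. \<bar>f x\<bar>) ` unit_ball_on V N)"
    by (auto simp: unit_ball_on_def intro!: bdd_aboveI)
  then show ?thesis
    unfolding dual_norm_on_def using assms by (intro cSUP_upper) (auto simp: unit_ball_on_def)
qed

lemma dual_sphere_le_norm:
  assumes f: "f \<in> dual_sphere_on V N" and x: "x \<in> V"
  shows "f x \<le> N x"
proof (cases "x = 0")
  case True
  have "f (0 *\<^sub>R x) = 0 * f x"
    using f x unfolding dual_sphere_on_def dual_on_def by blast
  then show ?thesis using True by simp
next
  case False
  then have "\<bar>f ((1 / N x) *\<^sub>R x)\<bar> \<le> 1"
    using dual_norm_upper[of f "(1 / N x) *\<^sub>R x"] f x norm_normalized
    by (auto simp: dual_sphere_on_def)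
  moreover have "f ((1 / N x) *\<^sub>R x) = (1 / N x) * f x"
    using f x unfolding dual_sphere_on_def dual_on_def by blast
  ultimately show ?thesis
    using norm_pos[OF x False] by (simp add: abs_le_iff field_simps)
qed

text \<open>A functional below \<open>N\<close> may have norm less than 1 on \<open>V\<close>.
  Dividing by its norm only raises nonnegative values, so lower bounds found for \<open>f\<close>
  survive; \<open>f x > 0\<close> keeps the divisor positive.\<close>

lemma normalize_functional:
  assumes f: "linear f" "\<And>v. v \<in> V \<Longrightarrow> f v \<le> N v" and x: "x \<in> V" "N x \<le> 1" "f x > 0"
  obtains g where "g \<in> dual_sphere_on V N" "\<And>v. f v \<ge> 0 \<Longrightarrow> f v \<le> g v"
proof -
  have abs_le: "\<bar>f v\<bar> \<le> N v" if "v \<in> V" for v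
    using f(2)[of v] f(2)[of "- v"] that norm_minus[of v] linear_neg[OF f(1), of v] by simp
  define s where "s = dual_norm_on V N f"
  have fdual: "f \<in> dual_on V N"
    using f(1) abs_le by (auto simp: dual_on_def linear_add linear_scale intro!: exI[of _ 1])
  have s: "\<bar>f v\<bar> \<le> s" if "v \<in> unit_ball_on V N" for v
    using dual_norm_upper[OF fdual] that by (simp add: unit_ball_on_def s_def)
  have xB: "x \<in> unit_ball_on V N" using x by (simp add: unit_ball_on_def)
  have spos: "s > 0" using s[OF xB] x(3) by simp
  have s1: "s \<le> 1"
    unfolding s_def dual_norm_on_def using xB abs_le
    by (intro cSUP_least) (auto simp: unit_ball_on_def intro: order_trans)
  define g where "g = (\<lambda>v. f v / s)"
  have gdual: "g \<in> dual_on V N"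
    unfolding dual_on_def g_def using f(1) abs_le spos
    by (auto simp: linear_add linear_scale add_divide_distrib divide_right_mono intro!: exI[of _ "1 / s"])
  have "dual_norm_on V N g = 1"
  proof (rule antisym)
    show "dual_norm_on V N g \<le> 1"
      unfolding dual_norm_on_def using xB s spos
      by (intro cSUP_least) (auto simp: g_def)
    have "\<bar>f v\<bar> \<le> s * dual_norm_on V N g" if "v \<in> unit_ball_on V N" for v
      using dual_norm_upper[OF gdual, of v] that spos
      by (simp add: unit_ball_on_def g_def divide_le_eq mult.commute)
    then have "s \<le> s * dual_norm_on V N g"
      using xB unfolding s_def dual_norm_on_def by (intro cSUP_least) auto
    then show "1 \<le> dual_norm_on V N g"
      using spos by simp
  qed
  moreover have "f v \<le> g v" if "f v \<ge> 0" for v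
    using that spos s1 mult_left_mono[of s 1 "f v"] by (simp add: g_def le_divide_eq)
  ultimately show ?thesis
    using that gdual by (simp add: dual_sphere_on_def)
qed

lemma dist_to_set_lessE:
  assumes "S \<subseteq> V" "y \<in> V" "S \<noteq> {}" "dist_to_set N y S < r"
  obtains z where "z \<in> S" "N (y - z) < r"
proof -
  have "bdd_below ((\<lambda>z. N (y - z)) ` S)"
    using assms norm_ge_0 by (auto intro!: bdd_belowI[of _ 0])
  then show ?thesis
    using assms that unfolding dist_to_set_def by (auto simp: cINF_less_iff)
qed

lemma dist_to_set_le:
  assumes "S \<subseteq> V" "y \<in> V" "z \<in> S"
  shows "dist_to_set N y S \<le> N (y - z)"
  unfolding dist_to_set_def using assms norm_ge_0
  by (intro cINF_lower) (auto intro!: bdd_belowI[of _ 0])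

lemma GL_space_imp_metric_GL:
  assumes "GL_space V N"
  shows "metric_GL V N"
  unfolding metric_GL_def
proof (intro ballI allI impI)
  fix x y and \<epsilon> :: real
  assume x: "x \<in> unit_sphere_on V N" and y: "y \<in> unit_sphere_on V N" and e: "\<epsilon> > 0"
  \<comment> \<open>A third of \<epsilon>, since three functional values are added to bound
    \<open>N (x + z + w)\<close> from below.\<close>
  define S where "S f = slice_on V N f (\<epsilon> / 3)" for f
  have SV: "S f \<subseteq> V" "uminus ` S f \<subseteq> V" for f
    by (auto simp: S_def slice_on_def unit_ball_on_def)
  have "\<forall>x\<in>unit_sphere_on V N. \<forall>\<epsilon>>0. \<exists>f\<in>dual_sphere_on V N.
        x \<in> slice_on V N f \<epsilon> \<and> (\<forall>y\<in>unit_sphere_on V N.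
             dist_to_set N y (slice_on V N f \<epsilon>) + dist_to_set N y (uminus ` slice_on V N f \<epsilon>) < 2 + \<epsilon>)"
    using assms by (simp add: GL_space_def Let_def)
  moreover have "\<epsilon> / 3 > 0" using e by simp
  ultimately obtain f where f: "f \<in> dual_sphere_on V N" "x \<in> S f"
      "dist_to_set N y (S f) + dist_to_set N y (uminus ` S f) < 2 + \<epsilon> / 3"
    using x y unfolding S_def by blast
  \<comment> \<open>Half of the slack in the strict inequality for each distance: the infima need
    not be attained.\<close>
  define \<eta> where "\<eta> = (2 + \<epsilon> / 3 - dist_to_set N y (S f) - dist_to_set N y (uminus ` S f)) / 2"
  have \<eta>: "\<eta> > 0" using f(3) by (simp add: \<eta>_def)
  have yV: "y \<in> V" using y by (simp add: unit_sphere_on_def)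
  obtain z where z: "z \<in> S f" "N (y - z) < dist_to_set N y (S f) + \<eta>"
    by (rule dist_to_set_lessE[OF SV(1) yV, of f "dist_to_set N y (S f) + \<eta>"]) (use f(2) \<eta> in auto)
  obtain w' where w': "w' \<in> uminus ` S f" "N (y - w') < dist_to_set N y (uminus ` S f) + \<eta>"
    by (rule dist_to_set_lessE[OF SV(2) yV, of f "dist_to_set N y (uminus ` S f) + \<eta>"]) (use f(2) \<eta> in auto)
  then obtain w where w: "w \<in> S f" "N (y + w) < dist_to_set N y (uminus ` S f) + \<eta>"
    by auto
  have mem: "v \<in> V \<and> N v \<le> 1 \<and> f v > 1 - \<epsilon> / 3" if "v \<in> S f" for v
    using that by (auto simp: S_def slice_on_def unit_ball_on_def)
  note mems = mem[OF f(2)] mem[OF z(1)] mem[OF w(1)]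
  have "f (x + z + w) = f x + f z + f w"
    using f(1) mems unfolding dual_sphere_on_def dual_on_def by auto
  then have "N (x + z + w) > 3 - \<epsilon>"
    using dual_sphere_le_norm[OF f(1), of "x + z + w"] mems by auto
  moreover have "N (y - z) + N (y + w) < 2 + \<epsilon>"
    using z(2) w(2) e by (simp add: \<eta>_def field_simps)
  ultimately show "\<exists>z\<in>unit_ball_on V N. \<exists>w\<in>unit_ball_on V N.
      N (x + z + w) > 3 - \<epsilon> \<and> N (y - z) + N (y + w) < 2 + \<epsilon>"
    using mems unfolding unit_ball_on_def by blast
qed

text \<open>If \<open>f (u (Suc n)) \<ge> 1 - d (Suc n)\<close>, then \<open>f (u n) + f (z n) + f
  (w n) \<ge> \<rho> n * (1 - d (Suc n)) \<ge> 3 - d n\<close>, and as each summand is at most 1,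
  each is at least \<open>1 - d n\<close>. Control thus passes from later to earlier indices, and
  the task is to have it at every index simultaneously.\<close>

lemma chain_functional:
  fixes u z w :: "nat \<Rightarrow> 'a" and \<delta> :: real
  defines "\<rho> \<equiv> \<lambda>n. N (u n + z n + w n)"
  assumes \<delta>: "0 < \<delta>" "\<delta> \<le> 1"
    and u: "\<And>n. u n \<in> V" "\<And>n. N (u n) = 1"
    and z: "\<And>n. z n \<in> V" "\<And>n. N (z n) \<le> 1"
    and w: "\<And>n. w n \<in> V" "\<And>n. N (w n) \<le> 1"
    and \<rho>: "\<And>n. \<rho> n > 3 - \<delta> / 4 ^ Suc n"
    and rec: "\<And>n. \<rho> n *\<^sub>R u (Suc n) = u n + z n + w n"
  obtains f where "linear f" "\<And>v. v \<in> V \<Longrightarrow> f v \<le> N v"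
    "\<And>n. f (u n) \<ge> 1 - \<delta>" "\<And>n. f (z n) \<ge> 1 - \<delta>" "\<And>n. f (w n) \<ge> 1 - \<delta>"
proof -
  define d where "d n = \<delta> / 4 ^ n" for n
  have d: "0 < d n" "d n \<le> \<delta>" "d (Suc n) = d n / 4" for n
    using \<delta> by (auto simp: d_def divide_le_eq one_le_power)
  \<comment> \<open>This is where the ratio 4 comes from: \<rho> loses \<open>d n / 4\<close>, and
    the factor \<open>1 - d n / 4\<close> costs about three times \<open>d n / 4\<close>. The
    remaining square has the favourable sign.\<close>
  have step: "3 - d n \<le> \<rho> n * (1 - d (Suc n))" for n
  proof -
    have "(3 - d n / 4) * (1 - d n / 4) \<le> \<rho> n * (1 - d n / 4)"
    proof (rule mult_right_mono)
      show "3 - d n / 4 \<le> \<rho> n" using \<rho>[of n] by (simp add: d_def mult.commute)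
      show "0 \<le> 1 - d n / 4" using d(2)[of n] \<delta> by linarith
    qed
    moreover have "(3 - d n / 4) * (1 - d n / 4) = 3 - d n + (d n / 4)\<^sup>2"
      by (simp add: power2_eq_square algebra_simps)
    ultimately show ?thesis
      by (smt (verit) d(3) zero_le_power2)
  qed
  have \<rho>0: "\<rho> n \<ge> 0" for n
    unfolding \<rho>_def using u z w norm_ge_0 by simp
  \<comment> \<open>Membership of \<open>(c, s)\<close> in \<open>K n\<close> says that \<open>f (u n) \<ge> 1 - d n\<close> forces \<open>f c \<ge> s\<close>. These cones
    increase with \<open>n\<close> because \<open>\<rho> n f (u (Suc n)) = f (u n) + f (z n) + f (w n)\<close>.\<close>
  define K where "K n = {(c, s). c \<in> V \<and> (\<exists>t\<ge>0. s \<le> t * (1 - d n) - N (c - t *\<^sub>R u n))}" for n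
  have "K n \<subseteq> K (Suc n)" for n
  proof clarify
    fix c s assume "(c, s) \<in> K n"
    then obtain t where t: "c \<in> V" "t \<ge> 0" "s \<le> t * (1 - d n) - N (c - t *\<^sub>R u n)"
      by (auto simp: K_def)
    have "N (z n + w n) \<le> 2"
      using norm_triangle[of "z n" "w n"] z[of n] w[of n] by linarith
    then have "t * N (z n + w n) \<le> t * 2"
      using t(2) by (intro mult_left_mono) auto
    \<comment> \<open>The new multiplier is \<open>t * \<rho> n\<close>. Replacing
      \<open>t *\<^sub>R u n\<close> by \<open>(t * \<rho> n) *\<^sub>R u (Suc n)\<close> changes
      the vector by \<open>t *\<^sub>R (z n + w n)\<close>, of norm at most \<open>2 * t\<close>;
      \<open>step\<close> pays for this because
      \<open>t * (3 - d n) - 2 * t = t * (1 - d n)\<close>.\<close>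
    moreover have eq: "c - (t * \<rho> n) *\<^sub>R u (Suc n) = (c - t *\<^sub>R u n) - t *\<^sub>R (z n + w n)"
      using rec[of n] by (simp add: scaleR_scaleR[symmetric] algebra_simps del: scaleR_scaleR)
    ultimately have "N (c - (t * \<rho> n) *\<^sub>R u (Suc n)) \<le> N (c - t *\<^sub>R u n) + 2 * t"
      using norm_diff_triangle[of "c - t *\<^sub>R u n" "t *\<^sub>R (z n + w n)"] t u z w
        norm_scale[of "z n + w n" t] unfolding eq by (simp add: mult.commute)
    moreover have "t * (3 - d n) \<le> t * (\<rho> n * (1 - d (Suc n)))"
      using step t(2) by (rule mult_left_mono)
    ultimately have "s \<le> (t * \<rho> n) * (1 - d (Suc n)) - N (c - (t * \<rho> n) *\<^sub>R u (Suc n))"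
      using t(3) by (simp add: algebra_simps)
    moreover have "0 \<le> t * \<rho> n" using t(2) \<rho>0 by simp
    ultimately show "(c, s) \<in> K (Suc n)"
      using t(1) unfolding K_def by blast
  qed
  then have mono: "K m \<subseteq> K n" if "m \<le> n" for m n
    using that by (rule lift_Suc_mono_le)
  have "\<exists>f. linear f \<and> (\<forall>v\<in>V. f v \<le> N v) \<and> (\<forall>c s. (c, s) \<in> (\<Union>n. K n) \<longrightarrow> s \<le> f c)"
  proof (rule dominated_functional[of "\<Union>n. K n"])
    show "(0, 0) \<in> (\<Union>n. K n)"
      by (auto simp: K_def intro!: exI[of _ 0])
  next
    fix c s assume "(c, s) \<in> (\<Union>n. K n)"
    then obtain n t where t: "c \<in> V" "t \<ge> 0" "s \<le> t * (1 - d n) - N (c - t *\<^sub>R u n)"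
      by (auto simp: K_def)
    have "t * (1 - d n) \<le> t * 1"
      using t(2) d(1)[of n] by (intro mult_left_mono) auto
    \<comment> \<open>Here \<open>t\<close> is the norm of \<open>t *\<^sub>R u n\<close>, which
      gives the compatibility of every demand with \<open>N\<close>.\<close>
    moreover have "t \<le> N c + N (c - t *\<^sub>R u n)"
      using norm_diff_triangle[of c "c - t *\<^sub>R u n"] norm_scale[of "u n" t] t u by simp
    ultimately show "c \<in> V \<and> s \<le> N c"
      using t by simp
  next
    fix c s e r assume "(c, s) \<in> (\<Union>n. K n)" "(e, r) \<in> (\<Union>n. K n)"
    then obtain m n where "(c, s) \<in> K m" "(e, r) \<in> K n" by blast
    then have "(c, s) \<in> K (max m n)" "(e, r) \<in> K (max m n)"
      using mono by (meson max.cobounded1 max.cobounded2 subsetD)+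
    then obtain k a b where ab: "c \<in> V" "a \<ge> 0" "s \<le> a * (1 - d k) - N (c - a *\<^sub>R u k)"
      "e \<in> V" "b \<ge> 0" "r \<le> b * (1 - d k) - N (e - b *\<^sub>R u k)"
      by (auto simp: K_def)
    have "N (c + e - (a + b) *\<^sub>R u k) \<le> N (c - a *\<^sub>R u k) + N (e - b *\<^sub>R u k)"
      using norm_triangle[of "c - a *\<^sub>R u k" "e - b *\<^sub>R u k"] ab u by (simp add: algebra_simps)
    then have "s + r \<le> (a + b) * (1 - d k) - N (c + e - (a + b) *\<^sub>R u k)"
      using ab by (simp add: algebra_simps)
    then have "(c + e, s + r) \<in> K k"
      using ab unfolding K_def by (auto intro!: exI[of _ "a + b"])
    then show "(c + e, s + r) \<in> (\<Union>n. K n)" by blast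
  next
    fix c s t assume "(c, s) \<in> (\<Union>n. K n)" and t: "(t::real) > 0"
    then obtain n a where a: "c \<in> V" "a \<ge> 0" "s \<le> a * (1 - d n) - N (c - a *\<^sub>R u n)"
      by (auto simp: K_def)
    have "t * s \<le> t * (a * (1 - d n) - N (c - a *\<^sub>R u n))"
      using a(3) t by (intro mult_left_mono) auto
    also have "\<dots> = (t * a) * (1 - d n) - N (t *\<^sub>R c - (t * a) *\<^sub>R u n)"
      using norm_scale[of "c - a *\<^sub>R u n" t] t a u by (simp add: right_diff_distrib scaleR_diff_right)
    finally have "(t *\<^sub>R c, t * s) \<in> K n"
      using t a unfolding K_def by (auto intro!: exI[of _ "t * a"])
    then show "(t *\<^sub>R c, t * s) \<in> (\<Union>n. K n)" by blast
  qed blast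
  then obtain f where "linear f \<and> (\<forall>v\<in>V. f v \<le> N v) \<and> (\<forall>c s. (c, s) \<in> (\<Union>n. K n) \<longrightarrow> s \<le> f c)" ..
  then have f: "linear f" "\<And>v. v \<in> V \<Longrightarrow> f v \<le> N v"
      "\<And>n c s. (c, s) \<in> K n \<Longrightarrow> s \<le> f c"
    by blast+
  have fu: "1 - d n \<le> f (u n)" for n
  proof (rule f(3))
    show "(u n, 1 - d n) \<in> K n"
      using u by (auto simp: K_def intro!: exI[of _ 1])
  qed
  have le1: "f (u n) \<le> 1" "f (z n) \<le> 1" "f (w n) \<le> 1" for n
    using f(2)[OF u(1)[of n]] f(2)[OF z(1)[of n]] f(2)[OF w(1)[of n]] u(2)[of n] z(2)[of n] w(2)[of n]
    by linarith+
  have sum: "f (u n) + f (z n) + f (w n) \<ge> 3 - d n" for n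
  proof -
    have "f (u n) + f (z n) + f (w n) = \<rho> n * f (u (Suc n))"
      using arg_cong[OF rec[of n], of f] f(1) by (simp add: linear_add linear_scale)
    also have "\<dots> \<ge> \<rho> n * (1 - d (Suc n))"
      using \<rho>0 fu by (intro mult_left_mono) auto
    finally show ?thesis using step[of n] by linarith
  qed
  show ?thesis
  proof (rule that[OF f(1,2)])
    fix n
    show "1 - \<delta> \<le> f (u n)" "1 - \<delta> \<le> f (z n)" "1 - \<delta> \<le> f (w n)"
      using sum[of n] le1[of n] d(2)[of n] by linarith+
  qed
qed

text \<open>The factor 2 arises because normalizing moves \<open>d\<close> by
  \<open>\<bar>N d - 1\<bar>\<close>, which is at most \<open>N (v - d)\<close> as \<open>v\<close>
  is a unit vector.\<close>

lemma normalized_close: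
  assumes "v \<in> V" "N v = 1" "d \<in> V" "d \<noteq> 0"
  shows "N (v - (1 / N d) *\<^sub>R d) \<le> 2 * N (v - d)"
proof -
  have "d - (1 / N d) *\<^sub>R d = (1 - 1 / N d) *\<^sub>R d"
    by (simp add: algebra_simps)
  then have "N (d - (1 / N d) *\<^sub>R d) = \<bar>1 - 1 / N d\<bar> * \<bar>N d\<bar>"
    using norm_scale[OF assms(3)] norm_ge_0[OF assms(3)] by simp
  also have "\<dots> = \<bar>N d - 1\<bar>"
    using norm_pos[OF assms(3,4)] by (simp only: abs_mult[symmetric]) (simp add: left_diff_distrib)
  also have "\<dots> \<le> N (v - d)"
    using norm_triangle_sub[of v d] norm_triangle_sub[of d v] norm_minus_commute[of v d] assms by simp
  finally show ?thesis
    using norm_triangle[of "v - d" "d - (1 / N d) *\<^sub>R d"] assms by simp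
qed

lemma separable_sphere_sequence:
  assumes sep: "separable_space (norm_topology V N)" and x: "x \<in> V" "N x = 1"
  shows "\<exists>y :: nat \<Rightarrow> 'a. (\<forall>n. y n \<in> V \<and> N (y n) = 1) \<and>
    (\<forall>v \<epsilon>. v \<in> V \<longrightarrow> N v = 1 \<longrightarrow> \<epsilon> > 0 \<longrightarrow> (\<exists>n. N (v - y n) < \<epsilon>))"
proof -
  obtain D where D: "countable D" "D \<subseteq> V" and dense: "\<And>v \<epsilon>. v \<in> V \<Longrightarrow> \<epsilon> > 0 \<Longrightarrow> \<exists>d\<in>D. N (v - d) < \<epsilon>"
    using sep unfolding separable_norm_topology_iff by blast
  define S where "S = (\<lambda>d. (1 / N d) *\<^sub>R d) ` (D - {0})"
  have approx: "\<exists>s\<in>S. N (v - s) < \<epsilon>" if v: "v \<in> V" "N v = 1" "\<epsilon> > 0" for v \<epsilon>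
  proof -
    \<comment> \<open>The bound 1 excludes \<open>d = 0\<close>; the half compensates for the factor
      lost in normalizing.\<close>
    obtain d where d: "d \<in> D" "N (v - d) < min 1 (\<epsilon> / 2)"
      using dense[OF v(1), of "min 1 (\<epsilon> / 2)"] v(3) by auto
    then have dV: "d \<in> V" "d \<noteq> 0"
      using D(2) v(2) by auto
    have "N (v - (1 / N d) *\<^sub>R d) < \<epsilon>"
      using normalized_close[OF v(1,2) dV] d(2) by simp
    then show ?thesis using d dV by (auto simp: S_def)
  qed
  have "S \<noteq> {}" using approx[OF x zero_less_one] by blast
  moreover have "countable S" using D by (simp add: S_def)
  ultimately have r: "range (from_nat_into S) = S" by (rule range_from_nat_into)
  have SV: "s \<in> V \<and> N s = 1" if "s \<in> S" for s
    using that D norm_normalized by (auto simp: S_def)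
  show ?thesis
  proof (intro exI[of _ "from_nat_into S"] conjI allI impI)
    show "from_nat_into S n \<in> V" "N (from_nat_into S n) = 1" for n
      using SV r by blast+
    show "\<exists>n. N (v - from_nat_into S n) < \<epsilon>" if "v \<in> V" "N v = 1" "\<epsilon> > 0" for v \<epsilon>
      using approx[OF that] r by (metis imageE)
  qed
qed

lemma separable_metric_GL_imp_GL_space:
  assumes Ban: "banach_space_on V N" and sep: "separable_space (norm_topology V N)"
    and GL: "metric_GL V N"
  shows "GL_space V N"
  unfolding GL_space_def Let_def
proof (intro conjI Ban ballI allI impI)
  fix x and \<epsilon> :: real assume "x \<in> unit_sphere_on V N" and e: "\<epsilon> > 0"
  then have x: "x \<in> V" "N x = 1" by (auto simp: unit_sphere_on_def)
  obtain y :: "nat \<Rightarrow> 'a" where y': "\<forall>n. y n \<in> V \<and> N (y n) = 1" and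
    dense: "\<forall>v \<epsilon>. v \<in> V \<longrightarrow> N v = 1 \<longrightarrow> \<epsilon> > 0 \<longrightarrow> (\<exists>n. N (v - y n) < \<epsilon>)"
    using separable_sphere_sequence[OF sep x] by blast
  from y' have y: "y n \<in> V" "N (y n) = 1" for n by auto
  \<comment> \<open>With \<open>N (v - y n) < \<delta>\<close> the two distances from
    \<open>v\<close> add up to less than \<open>2 + 3 * \<delta>\<close>, so a quarter of \<epsilon>
    suffices. The bound 1/2 makes \<open>f x\<close> positive.\<close>
  define \<delta> where "\<delta> = min (1 / 2) (\<epsilon> / 4)"
  have \<delta>: "0 < \<delta>" "\<delta> \<le> 1 / 2" "\<delta> \<le> \<epsilon> / 4" using e by (auto simp: \<delta>_def)
  let ?Q = "\<lambda>(n::nat) a b. \<exists>z w. z \<in> V \<and> N z \<le> 1 \<and> w \<in> V \<and> N w \<le> 1 \<and> N (a + z + w) > 3 - \<delta> / 4 ^ Suc n \<and>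
      N (y n - z) + N (y n + w) < 2 + \<delta> \<and> N (a + z + w) *\<^sub>R b = a + z + w"
  \<comment> \<open>The recursion runs on \<open>u\<close> alone: \<open>z\<close> and
    \<open>w\<close> stay existential inside \<open>?Q\<close> and are selected afterwards. The
    clause for \<open>n = 0\<close> fixes the start at \<open>x\<close>, so the functional will be
    almost 1 there.\<close>
  have "\<exists>u. \<forall>n. (u n \<in> V \<and> N (u n) = 1 \<and> (n = 0 \<longrightarrow> u n = x)) \<and> ?Q n (u n) (u (Suc n))"
  proof (rule dependent_nat_choice[of "\<lambda>n a. a \<in> V \<and> N a = 1 \<and> (n = 0 \<longrightarrow> a = x)" ?Q])
    show "\<exists>a. a \<in> V \<and> N a = 1 \<and> (0 = (0::nat) \<longrightarrow> a = x)" using x by blast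
  next
    fix a and n :: nat assume a: "a \<in> V \<and> N a = 1 \<and> (n = 0 \<longrightarrow> a = x)"
    have small: "0 < \<delta> / 4 ^ Suc n" "\<delta> / 4 ^ Suc n \<le> \<delta>"
      using \<delta>(1) by (auto simp: divide_le_eq one_le_power simp del: power_Suc)
    obtain z w where zw: "z \<in> V" "N z \<le> 1" "w \<in> V" "N w \<le> 1" "N (a + z + w) > 3 - \<delta> / 4 ^ Suc n"
        "N (y n - z) + N (y n + w) < 2 + \<delta> / 4 ^ Suc n"
      using metric_GLD[OF GL, of a "y n" "\<delta> / 4 ^ Suc n"] a y small by blast
    define b where "b = (1 / N (a + z + w)) *\<^sub>R (a + z + w)"
    have "N (a + z + w) > 0" using zw(5) small \<delta> by linarith
    moreover from this have "a + z + w \<noteq> 0" using norm_0 by force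
    ultimately have "b \<in> V" "N b = 1" "N (a + z + w) *\<^sub>R b = a + z + w"
      using a zw norm_normalized[of "a + z + w"] by (auto simp: b_def)
    moreover have "N (y n - z) + N (y n + w) < 2 + \<delta>" using zw(6) small by linarith
    ultimately show "\<exists>b. (b \<in> V \<and> N b = 1 \<and> (Suc n = 0 \<longrightarrow> b = x)) \<and> ?Q n a b"
      using zw by blast
  qed
  then obtain u where u: "\<And>n. u n \<in> V" "\<And>n. N (u n) = 1" "u 0 = x" and Q: "\<And>n. ?Q n (u n) (u (Suc n))"
    by blast
  obtain z w where zw: "\<And>n. z n \<in> V" "\<And>n. N (z n) \<le> 1" "\<And>n. w n \<in> V" "\<And>n. N (w n) \<le> 1"
      "\<And>n. N (u n + z n + w n) > 3 - \<delta> / 4 ^ Suc n"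
      "\<And>n. N (y n - z n) + N (y n + w n) < 2 + \<delta>"
      "\<And>n. N (u n + z n + w n) *\<^sub>R u (Suc n) = u n + z n + w n"
    using Q by metis
  obtain f where f: "linear f" "\<And>v. v \<in> V \<Longrightarrow> f v \<le> N v"
      "\<And>n. f (u n) \<ge> 1 - \<delta>" "\<And>n. f (z n) \<ge> 1 - \<delta>" "\<And>n. f (w n) \<ge> 1 - \<delta>"
    by (rule chain_functional[of \<delta> u z w]) (use \<delta> u zw in auto)
  have fx: "f x > 0" using f(3)[of 0] u(3) \<delta> by simp
  obtain g where g: "g \<in> dual_sphere_on V N" "\<And>v. f v \<ge> 0 \<Longrightarrow> f v \<le> g v"
    by (rule normalize_functional[OF f(1,2) x(1) _ fx]) (use x(2) in auto)
  have slice: "v \<in> slice_on V N g \<epsilon>" if "v \<in> V" "N v \<le> 1" "f v \<ge> 1 - \<delta>" for v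
    using that g(2)[of v] \<delta> e by (simp add: slice_on_def unit_ball_on_def)
  have SV: "slice_on V N g \<epsilon> \<subseteq> V" "uminus ` slice_on V N g \<epsilon> \<subseteq> V"
    by (auto simp: slice_on_def unit_ball_on_def)
  show "\<exists>f\<in>dual_sphere_on V N. x \<in> slice_on V N f \<epsilon> \<and> (\<forall>y\<in>unit_sphere_on V N.
      dist_to_set N y (slice_on V N f \<epsilon>) + dist_to_set N y (uminus ` slice_on V N f \<epsilon>) < 2 + \<epsilon>)"
  proof (intro bexI[OF _ g(1)] conjI ballI)
    show "x \<in> slice_on V N g \<epsilon>" using slice x f(3)[of 0] u(3) by simp
  next
    fix v assume "v \<in> unit_sphere_on V N"
    then have v: "v \<in> V" "N v = 1" by (auto simp: unit_sphere_on_def)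
    obtain n where n: "N (v - y n) < \<delta>" using dense[rule_format, OF v \<delta>(1)] by blast
    have "dist_to_set N v (slice_on V N g \<epsilon>) \<le> N (v - z n)"
      by (rule dist_to_set_le[OF SV(1) v(1) slice[OF zw(1,2) f(4)]])
    moreover have "dist_to_set N v (uminus ` slice_on V N g \<epsilon>) \<le> N (v - - w n)"
      by (rule dist_to_set_le[OF SV(2) v(1) imageI[OF slice[OF zw(3,4) f(5)]]])
    moreover have "N (v - z n) \<le> N (v - y n) + N (y n - z n)"
      using norm_triangle[of "v - y n" "y n - z n"] v y zw by simp
    moreover have "N (v + w n) \<le> N (v - y n) + N (y n + w n)"
      using norm_triangle[of "v - y n" "y n + w n"] v y zw by simp
    ultimately show "dist_to_set N v (slice_on V N g \<epsilon>) + dist_to_set N v (uminus ` slice_on V N g \<epsilon>) < 2 + \<epsilon>"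
      using n zw(6)[of n] \<delta> by simp
  qed
qed

end

section \<open>Closing off: separable subspaces with the metric condition\<close>

text \<open>A Loewenheim-Skolem argument: the union of countably many rounds is closed since any two
  of its elements already occur in a common round. Binary operations also cover unary ones, which
  ignore an argument.\<close>

lemma countable_closed_superset:
  fixes F :: "('a \<Rightarrow> 'a \<Rightarrow> 'a) set"
  assumes "countable A" "countable F" "A \<subseteq> V"
    and V: "\<And>g a b. g \<in> F \<Longrightarrow> a \<in> V \<Longrightarrow> b \<in> V \<Longrightarrow> g a b \<in> V"
  shows "\<exists>B. countable B \<and> A \<subseteq> B \<and> B \<subseteq> V \<and> (\<forall>g\<in>F. \<forall>a\<in>B. \<forall>b\<in>B. g a b \<in> B)"
proof -
  define step where "step S = S \<union> (\<Union>g\<in>F. (\<lambda>(a, b). g a b) ` (S \<times> S))" for S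
  define T where "T n = (step ^^ n) A" for n
  have T0: "T 0 = A" and TS: "T (Suc n) = step (T n)" for n
    by (simp_all add: T_def)
  have inc: "T n \<subseteq> T (Suc n)" for n
    by (auto simp: TS step_def)
  have mono: "T m \<subseteq> T n" if "m \<le> n" for m n
    using inc that by (rule lift_Suc_mono_le)
  have "countable (T n)" for n
    by (induction n) (use assms in \<open>auto simp: T0 TS step_def\<close>)
  moreover have "T n \<subseteq> V" for n
  proof (induction n)
    case (Suc n)
    have "g a b \<in> V" if "g \<in> F" "a \<in> T n" "b \<in> T n" for g a b
      using V[OF that(1)] that(2,3) Suc by blast
    then show ?case using Suc by (auto simp: TS step_def)
  qed (simp add: T0 assms)
  moreover have "g a b \<in> (\<Union>n. T n)" if g: "g \<in> F" "a \<in> (\<Union>n. T n)" "b \<in> (\<Union>n. T n)" for g a b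
  proof -
    from g obtain m n where "a \<in> T m" "b \<in> T n" by blast
    then have "a \<in> T (max m n)" "b \<in> T (max m n)"
      using mono[of m "max m n"] mono[of n "max m n"] by auto
    then have "(a, b) \<in> T (max m n) \<times> T (max m n)" by simp
    then have "(\<lambda>(a, b). g a b) (a, b) \<in> T (Suc (max m n))"
      using g(1) unfolding TS step_def by blast
    then have "g a b \<in> T (Suc (max m n))" by simp
    then show ?thesis by blast
  qed
  ultimately show ?thesis
    using T0 by (intro exI[of _ "\<Union>n. T n"]) auto
qed

context normed_on
begin

lemma banach_space_on_closed_subspace:
  assumes Ban: "banach_space_on V N" and Y: "subspace Y" "Y \<subseteq> V"
    and cl: "\<And>x. x \<in> V \<Longrightarrow> (\<And>\<epsilon>. \<epsilon> > 0 \<Longrightarrow> \<exists>y\<in>Y. N (x - y) < \<epsilon>) \<Longrightarrow> x \<in> Y"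
  shows "banach_space_on Y N"
proof -
  interpret Y: normed_on Y N by (rule subspace_normed_on[OF Y])
  have compl: "mcomplete" using Ban by (simp add: banach_space_on_def)
  have "Y.mcomplete"
    unfolding Y.mcomplete_iff
  proof (intro allI impI)
    fix s :: "nat \<Rightarrow> 'a" assume s: "\<forall>n. s n \<in> Y" and Cauchy: "\<forall>\<epsilon>>0. \<exists>M. \<forall>m\<ge>M. \<forall>n\<ge>M. N (s m - s n) < \<epsilon>"
    have "\<forall>n. s n \<in> V" using s Y(2) by blast
    then have "\<exists>x\<in>V. \<forall>\<epsilon>>0. \<exists>M. \<forall>n\<ge>M. N (s n - x) < \<epsilon>"
      using compl Cauchy unfolding mcomplete_iff by simp
    then obtain x where x: "x \<in> V" "\<forall>\<epsilon>>0. \<exists>M. \<forall>n\<ge>M. N (s n - x) < \<epsilon>" ..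
    have "x \<in> Y"
    proof (rule cl[OF x(1)])
      fix \<epsilon> :: real assume "\<epsilon> > 0"
      then obtain M where "N (s M - x) < \<epsilon>" using x(2) by blast
      then show "\<exists>y\<in>Y. N (x - y) < \<epsilon>"
        using s x(1) Y(2) norm_minus_commute by (metis subsetD)
    qed
    then show "\<exists>x\<in>Y. \<forall>\<epsilon>>0. \<exists>M. \<forall>n\<ge>M. N (s n - x) < \<epsilon>"
      using x(2) by blast
  qed
  then show ?thesis
    using Y.normed by (simp add: banach_space_on_def)
qed

text \<open>A countable form of the condition, fit for closing off. The members of \<open>D\<close>
  are normalized inside the inequalities, because \<open>D\<close> will be closed under rational
  scalars only and need not contain its normalized vectors.\<close>

lemma metric_GL_dense:
  assumes D: "D \<subseteq> V" and dense: "\<And>x \<epsilon>. x \<in> V \<Longrightarrow> \<epsilon> > 0 \<Longrightarrow> \<exists>d\<in>D. N (x - d) < \<epsilon>"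
    and GL: "\<And>d e n. d \<in> D \<Longrightarrow> d \<noteq> 0 \<Longrightarrow> e \<in> D \<Longrightarrow> e \<noteq> 0 \<Longrightarrow>
      \<exists>z\<in>V. \<exists>w\<in>V. N z \<le> 1 \<and> N w \<le> 1 \<and> N ((1 / N d) *\<^sub>R d + z + w) > 3 - 1 / real (Suc n) \<and>
        N ((1 / N e) *\<^sub>R e - z) + N ((1 / N e) *\<^sub>R e + w) < 2 + 1 / real (Suc n)"
  shows "metric_GL V N"
  unfolding metric_GL_def
proof (intro ballI allI impI)
  fix x y and \<epsilon> :: real
  assume "x \<in> unit_sphere_on V N" "y \<in> unit_sphere_on V N" and e: "\<epsilon> > 0"
  then have x: "x \<in> V" "N x = 1" and y: "y \<in> V" "N y = 1" by (auto simp: unit_sphere_on_def)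
  \<comment> \<open>With tolerance \<open>h\<close>, each replacement of a unit vector by a
    normalized member of \<open>D\<close> costs at most \<open>2 * h\<close>. The vector
    \<open>y\<close> occurs twice, so the total loss there is \<open>5 * h\<close>.\<close>
  obtain n where n: "1 / real (Suc n) < \<epsilon> / 5"
    using e reals_Archimedean[of "\<epsilon> / 5"] by (auto simp: inverse_eq_divide)
  define h where "h = 1 / real (Suc n)"
  define \<delta> where "\<delta> = min 1 h"
  have h: "h > 0" by (simp add: h_def)
  then have \<delta>: "\<delta> > 0" by (simp add: \<delta>_def)
  obtain a where a: "a \<in> D" "N (x - a) < \<delta>" using dense[OF x(1) \<delta>] by blast
  obtain b where b: "b \<in> D" "N (y - b) < \<delta>" using dense[OF y(1) \<delta>] by blast
  have ab: "a \<in> V" "b \<in> V" "a \<noteq> 0" "b \<noteq> 0"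
    using a b x y D by (auto simp: \<delta>_def)
  define a' b' where "a' = (1 / N a) *\<^sub>R a" and "b' = (1 / N b) *\<^sub>R b"
  have ab': "a' \<in> V" "b' \<in> V" using ab by (auto simp: a'_def b'_def)
  have close: "N (x - a') < 2 * h" "N (y - b') < 2 * h"
    using normalized_close[OF x ab(1,3)] normalized_close[OF y ab(2,4)] a(2) b(2)
    by (auto simp: a'_def b'_def \<delta>_def)
  obtain z w where zw: "z \<in> V" "w \<in> V" "N z \<le> 1" "N w \<le> 1" "N (a' + z + w) > 3 - h"
      "N (b' - z) + N (b' + w) < 2 + h"
    using GL[OF a(1) ab(3) b(1) ab(4)] unfolding a'_def b'_def h_def by blast
  have "N (a' + z + w) - N (x - a') \<le> N (x + z + w)"
    using norm_triangle_add[of "a' + z + w" "x - a'"] zw ab' x by (simp add: algebra_simps)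
  moreover have "N (y - z) \<le> N (y - b') + N (b' - z)"
    using norm_triangle[of "y - b'" "b' - z"] zw ab' y by simp
  moreover have "N (y + w) \<le> N (y - b') + N (b' + w)"
    using norm_triangle[of "y - b'" "b' + w"] zw ab' y by simp
  ultimately have "N (x + z + w) > 3 - \<epsilon>" "N (y - z) + N (y + w) < 2 + \<epsilon>"
    using close zw(5,6) n h unfolding h_def[symmetric] by simp_all
  then show "\<exists>z\<in>unit_ball_on V N. \<exists>w\<in>unit_ball_on V N. N (x + z + w) > 3 - \<epsilon> \<and> N (y - z) + N (y + w) < 2 + \<epsilon>"
    using zw unfolding unit_ball_on_def by blast
qed

text \<open>Rational scalars keep \<open>D\<close> countable; real ones return in the closure by
  approximating scalar and vector separately.\<close>

lemma subspace_closure: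
  assumes D: "D \<subseteq> V" "0 \<in> D" and add: "\<And>a b. a \<in> D \<Longrightarrow> b \<in> D \<Longrightarrow> a + b \<in> D"
    and scale: "\<And>q a. a \<in> D \<Longrightarrow> q \<in> \<rat> \<Longrightarrow> q *\<^sub>R a \<in> D"
  shows "subspace {x \<in> V. \<forall>\<epsilon>>0. \<exists>d\<in>D. N (x - d) < \<epsilon>}"
  unfolding subspace_def
proof (intro conjI ballI allI; clarsimp)
  show "\<exists>d\<in>D. N (- d) < \<epsilon>" if "\<epsilon> > 0" for \<epsilon>
    using that D by (intro bexI[of _ 0]) auto
next
  fix x y \<epsilon> assume x: "x \<in> V" "\<forall>\<epsilon>>0. \<exists>d\<in>D. N (x - d) < \<epsilon>" and y: "y \<in> V" "\<forall>\<epsilon>>0. \<exists>d\<in>D. N (y - d) < \<epsilon>"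
    and e: "(\<epsilon>::real) > 0"
  obtain d where d: "d \<in> D" "N (x - d) < \<epsilon> / 2" using x(2) e half_gt_zero by blast
  obtain e where e: "e \<in> D" "N (y - e) < \<epsilon> / 2" using y(2) \<open>\<epsilon> > 0\<close> half_gt_zero by blast
  have "N (x + y - (d + e)) \<le> N (x - d) + N (y - e)"
    using norm_triangle[of "x - d" "y - e"] d e D x y by (auto simp: algebra_simps)
  then show "\<exists>d\<in>D. N (x + y - d) < \<epsilon>"
    using d e add by (intro bexI[of _ "d + e"]) auto
next
  fix c x \<epsilon> assume x: "x \<in> V" "\<forall>\<epsilon>>0. \<exists>d\<in>D. N (x - d) < \<epsilon>" and e: "(\<epsilon>::real) > 0"
  define \<eta> where "\<eta> = \<epsilon> / 2 / (N x + 1)"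
  have Nx: "N x + 1 > 0" using norm_ge_0[OF x(1)] by simp
  then have \<eta>: "\<eta> > 0" using e by (simp add: \<eta>_def)
  \<comment> \<open>The scalar is fixed before the vector, since the tolerance for \<open>d\<close>
    depends on \<open>q\<close>.\<close>
  obtain q where q: "q \<in> \<rat>" "\<bar>c - q\<bar> < \<eta>"
    using Rats_dense_in_real[of "c - \<eta>" "c + \<eta>"] \<eta> by (auto simp: abs_less_iff)
  obtain d where d: "d \<in> D" "N (x - d) < \<epsilon> / 2 / (\<bar>q\<bar> + 1)"
    using x(2) e by (metis abs_ge_zero add_nonneg_pos divide_pos_pos half_gt_zero zero_less_one)
  have dV: "d \<in> V" using d D by blast
  have "N (c *\<^sub>R x - q *\<^sub>R d) \<le> \<bar>c - q\<bar> * N x + \<bar>q\<bar> * N (x - d)"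
    using norm_triangle[of "(c - q) *\<^sub>R x" "q *\<^sub>R (x - d)"] x(1) dV
      norm_scale[of x "c - q"] norm_scale[of "x - d" q] by (simp add: algebra_simps)
  also have "\<bar>c - q\<bar> * N x \<le> \<eta> * N x"
    using q norm_ge_0[OF x(1)] by (intro mult_right_mono) auto
  also have "\<eta> * N x < \<epsilon> / 2"
    using Nx e by (simp add: \<eta>_def field_simps)
  also have "\<bar>q\<bar> * N (x - d) \<le> (\<bar>q\<bar> + 1) * N (x - d)"
    using norm_ge_0[of "x - d"] x(1) dV by (intro mult_right_mono) auto
  also have "(\<bar>q\<bar> + 1) * N (x - d) < \<epsilon> / 2"
    using pos_less_divide_eq[THEN iffD1, OF _ d(2)] by (simp add: mult.commute)
  finally have "N (c *\<^sub>R x - q *\<^sub>R d) < \<epsilon>" by simp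
  then show "\<exists>d\<in>D. N (c *\<^sub>R x - d) < \<epsilon>"
    using d q scale by blast
qed

lemma metric_GL_imp_local_GL_space:
  assumes Ban: "banach_space_on V N" and GL: "metric_GL V N"
  shows "local_GL_space V N"
  unfolding local_GL_space_def
proof (intro conjI Ban allI impI; elim conjE)
  fix X assume X: "subspace X" "X \<subseteq> V" and sep: "separable_space (norm_topology X N)"
  interpret X: normed_on X N by (rule subspace_normed_on[OF X])
  obtain D0 where D0: "countable D0" "D0 \<subseteq> X" and dense0: "\<forall>x\<in>X. \<forall>\<epsilon>>0. \<exists>d\<in>D0. N (x - d) < \<epsilon>"
    using sep unfolding X.separable_norm_topology_iff by blast
  have "\<forall>n d e. \<exists>z w. d \<in> V \<and> d \<noteq> 0 \<and> e \<in> V \<and> e \<noteq> 0 \<longrightarrow> z \<in> V \<and> w \<in> V \<and> N z \<le> 1 \<and> N w \<le> 1 \<and>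
      N ((1 / N d) *\<^sub>R d + z + w) > 3 - 1 / real (Suc n) \<and>
      N ((1 / N e) *\<^sub>R e - z) + N ((1 / N e) *\<^sub>R e + w) < 2 + 1 / real (Suc n)" (is "\<forall>n d e. \<exists>z w. ?P d e \<longrightarrow> ?Q n d e z w")
  proof (intro allI)
    fix n :: nat and d e
    show "\<exists>z w. ?P d e \<longrightarrow> ?Q n d e z w"
    proof (cases "?P d e")
      case True
      have "0 < 1 / real (Suc n)" by simp
      then obtain z w where "?Q n d e z w"
        using metric_GLD[OF GL, of "(1 / N d) *\<^sub>R d" "(1 / N e) *\<^sub>R e" "1 / real (Suc n)"] True norm_normalized
        by (metis mem(5))
      then show ?thesis by blast
    qed blast
  qed
  then obtain Z W where ZW: "\<And>n d e. ?P d e \<Longrightarrow> ?Q n d e (Z n d e) (W n d e)"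
    by metis
  \<comment> \<open>The default 0 makes the choice functions map all pairs from \<open>V\<close>
    into \<open>V\<close>, as closing off requires.\<close>
  define Z' where "Z' n d e = (if d \<in> V \<and> d \<noteq> 0 \<and> e \<in> V \<and> e \<noteq> 0 then Z n d e else 0)" for n d e
  define W' where "W' n d e = (if d \<in> V \<and> d \<noteq> 0 \<and> e \<in> V \<and> e \<noteq> 0 then W n d e else 0)" for n d e
  \<comment> \<open>Addition and rational scaling make the closure of \<open>D\<close> a subspace;
    \<open>Z'\<close> and \<open>W'\<close> put the witnesses of the metric condition into
    it.\<close>
  define F where "F = insert (+) ((\<lambda>q a b. q *\<^sub>R a) ` \<rat>) \<union> range Z' \<union> range W'"
  have "countable F" by (simp add: F_def countable_rat)
  moreover have "countable (insert 0 D0)" "insert 0 D0 \<subseteq> V" using D0 X by auto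
  moreover have "g a b \<in> V" if "g \<in> F" "a \<in> V" "b \<in> V" for g a b
    using that ZW unfolding F_def Z'_def W'_def by auto
  ultimately have "\<exists>D. countable D \<and> insert 0 D0 \<subseteq> D \<and> D \<subseteq> V \<and> (\<forall>g\<in>F. \<forall>a\<in>D. \<forall>b\<in>D. g a b \<in> D)"
    by (intro countable_closed_superset)
  then obtain D where D: "countable D" "insert 0 D0 \<subseteq> D" "D \<subseteq> V"
      and clos: "\<forall>g\<in>F. \<forall>a\<in>D. \<forall>b\<in>D. g a b \<in> D"
    by blast
  have addD: "a + b \<in> D" if "a \<in> D" "b \<in> D" for a b
    using clos that by (simp add: F_def)
  have scaleD: "q *\<^sub>R a \<in> D" if "a \<in> D" "q \<in> \<rat>" for q a
    using clos[rule_format, of "\<lambda>a b. q *\<^sub>R a" a a] that by (auto simp: F_def)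
  have ZD: "Z' n a b \<in> D" "W' n a b \<in> D" if "a \<in> D" "b \<in> D" for n a b
    using clos that by (simp_all add: F_def)
  define Y where "Y = {x \<in> V. \<forall>\<epsilon>>0. \<exists>d\<in>D. N (x - d) < \<epsilon>}"
  have subY: "subspace Y"
    unfolding Y_def using D addD scaleD by (intro subspace_closure) auto
  have YV: "Y \<subseteq> V" by (auto simp: Y_def)
  have DY: "D \<subseteq> Y" using D by (force simp: Y_def)
  interpret Y: normed_on Y N by (rule subspace_normed_on[OF subY YV])
  have XY: "X \<subseteq> Y" using X dense0 D(2) unfolding Y_def by (blast intro: order_trans)
  have closed: "x \<in> Y" if x: "x \<in> V" "\<And>\<epsilon>. \<epsilon> > 0 \<Longrightarrow> \<exists>y\<in>Y. N (x - y) < \<epsilon>" for x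
  proof -
    have "\<exists>d\<in>D. N (x - d) < \<epsilon>" if e: "\<epsilon> > 0" for \<epsilon>
    proof -
      obtain y where y: "y \<in> Y" "N (x - y) < \<epsilon> / 2" using x(2) half_gt_zero[OF e] by blast
      then obtain d where d: "d \<in> D" "N (y - d) < \<epsilon> / 2"
        using half_gt_zero[OF e] unfolding Y_def by blast
      have "N (x - d) \<le> N (x - y) + N (y - d)"
        using norm_triangle[of "x - y" "y - d"] x(1) y(1) d(1) YV D(3) by auto
      then show ?thesis using d y by (intro bexI[of _ d]) auto
    qed
    then show ?thesis using x(1) by (simp add: Y_def)
  qed
  have denseY: "\<And>x \<epsilon>. x \<in> Y \<Longrightarrow> \<epsilon> > 0 \<Longrightarrow> \<exists>d\<in>D. N (x - d) < \<epsilon>"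
    by (simp add: Y_def)
  have "metric_GL Y N"
  proof (rule Y.metric_GL_dense[OF DY denseY])
    fix d e and n :: nat assume de: "d \<in> D" "d \<noteq> 0" "e \<in> D" "e \<noteq> 0"
    then have P: "?P d e" using D(3) by blast
    have "Z n d e \<in> Y" "W n d e \<in> Y"
      using ZD[OF de(1,3), of n] P DY by (auto simp: Z'_def W'_def)
    then show "\<exists>z\<in>Y. \<exists>w\<in>Y. N z \<le> 1 \<and> N w \<le> 1 \<and> N ((1 / N d) *\<^sub>R d + z + w) > 3 - 1 / real (Suc n) \<and>
        N ((1 / N e) *\<^sub>R e - z) + N ((1 / N e) *\<^sub>R e + w) < 2 + 1 / real (Suc n)"
      using ZW[OF P, of n] by blast
  qed
  moreover have "separable_space (norm_topology Y N)"
    unfolding Y.separable_norm_topology_iff using D(1) DY denseY by (intro exI[of _ D]) simp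
  moreover have "banach_space_on Y N"
    by (rule banach_space_on_closed_subspace[OF Ban subY YV closed])
  ultimately have "GL_space Y N"
    by (intro Y.separable_metric_GL_imp_GL_space)
  moreover have "closedin (norm_topology V N) Y"
    by (rule closedin_norm_topologyI[OF YV closed])
  ultimately show "\<exists>Y. X \<subseteq> Y \<and> Y \<subseteq> V \<and> subspace Y \<and> closedin (norm_topology V N) Y \<and> GL_space Y N"
    using XY YV subY by blast
qed

lemma separable_span_pair:
  assumes "x \<in> V" "y \<in> V"
  shows "separable_space (norm_topology (span {x, y}) N)"
proof -
  have sub: "span {x, y} \<subseteq> V"
    using assms carrier_subspace by (intro span_minimal) auto
  interpret X: normed_on "span {x, y}" N by (rule subspace_normed_on[OF subspace_span sub])
  define D where "D = (\<lambda>(a, b). a *\<^sub>R x + b *\<^sub>R y) ` (\<rat> \<times> \<rat>)"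
  have "countable D" by (auto simp: D_def countable_rat)
  moreover have "D \<subseteq> span {x, y}"
    by (auto simp: D_def intro!: span_add span_scale intro: span_base)
  moreover have "\<exists>d\<in>D. N (v - d) < \<epsilon>" if v: "v \<in> span {x, y}" and e: "\<epsilon> > 0" for v \<epsilon>
  proof -
    obtain a b where ab: "v = a *\<^sub>R x + b *\<^sub>R y"
      using v by (auto simp: span_insert span_singleton algebra_simps)
    define \<eta> where "\<eta> = \<epsilon> / (N x + N y + 1)"
    have pos: "N x + N y + 1 > 0" using norm_ge_0 assms by (simp add: add_nonneg_pos)
    then have \<eta>: "\<eta> > 0" using e by (simp add: \<eta>_def)
    obtain p where p: "p \<in> \<rat>" "\<bar>a - p\<bar> < \<eta>"
      using Rats_dense_in_real[of "a - \<eta>" "a + \<eta>"] \<eta> by (auto simp: abs_less_iff)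
    obtain q where q: "q \<in> \<rat>" "\<bar>b - q\<bar> < \<eta>"
      using Rats_dense_in_real[of "b - \<eta>" "b + \<eta>"] \<eta> by (auto simp: abs_less_iff)
    have "N (v - (p *\<^sub>R x + q *\<^sub>R y)) \<le> \<bar>a - p\<bar> * N x + \<bar>b - q\<bar> * N y"
      using norm_triangle[of "(a - p) *\<^sub>R x" "(b - q) *\<^sub>R y"] assms
        norm_scale[of x "a - p"] norm_scale[of y "b - q"] by (simp add: ab algebra_simps)
    also have "\<dots> \<le> \<eta> * N x + \<eta> * N y"
      using p q assms norm_ge_0 by (intro add_mono mult_right_mono) auto
    also have "\<dots> < \<eta> * (N x + N y + 1)"
      using \<eta> by (simp add: algebra_simps)
    also have "\<dots> = \<epsilon>" using pos by (simp add: \<eta>_def)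
    finally show ?thesis
      using p q by (auto simp: D_def)
  qed
  ultimately show ?thesis
    unfolding X.separable_norm_topology_iff by blast
qed

text \<open>From left to right, a GL-subspace around the separable span of \<open>x\<close> and
  \<open>y\<close> contains suitable \<open>z\<close> and \<open>w\<close>, and these keep their
  norms in \<open>V\<close>. A statement about norms of a pair of vectors passes to the larger space
  in this way, whereas distances to a slice given by a functional on the subspace would not do so
  directly.\<close>

theorem local_GL_space_iff_metric_GL:
  assumes Ban: "banach_space_on V N"
  shows "local_GL_space V N \<longleftrightarrow> metric_GL V N"
proof
  assume L: "local_GL_space V N"
  show "metric_GL V N"
    unfolding metric_GL_def
  proof (intro ballI)
    fix x y assume xy: "x \<in> unit_sphere_on V N" "y \<in> unit_sphere_on V N"
    then have xyV: "x \<in> V" "y \<in> V" by (auto simp: unit_sphere_on_def)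
    have "span {x, y} \<subseteq> V"
      using xyV carrier_subspace by (intro span_minimal) auto
    then obtain Y where Y: "span {x, y} \<subseteq> Y" "Y \<subseteq> V" "subspace Y" "GL_space Y N"
      using L separable_span_pair[OF xyV] subspace_span[of "{x, y}"] unfolding local_GL_space_def by meson
    interpret Y: normed_on Y N by (rule subspace_normed_on[OF Y(3,2)])
    have "x \<in> unit_sphere_on Y N" "y \<in> unit_sphere_on Y N"
      using xy Y(1) span_base[of x "{x, y}"] span_base[of y "{x, y}"] by (auto simp: unit_sphere_on_def)
    moreover have "unit_ball_on Y N \<subseteq> unit_ball_on V N"
      using Y(2) by (auto simp: unit_ball_on_def)
    ultimately show "\<forall>\<epsilon>>0. \<exists>z\<in>unit_ball_on V N. \<exists>w\<in>unit_ball_on V N.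
        N (x + z + w) > 3 - \<epsilon> \<and> N (y - z) + N (y + w) < 2 + \<epsilon>"
      using Y.GL_space_imp_metric_GL[OF Y(4)] unfolding metric_GL_def by (meson subsetD)
  qed
qed (rule metric_GL_imp_local_GL_space[OF Ban])

section \<open>The metric condition for vectors that are not normalized\<close>

text \<open>Made for the c0-sum, where a coordinate of a unit vector only lies in the ball. With
  \<open>y = s *\<^sub>R v\<close> the witnesses of \<open>v\<close> are used unscaled, so that the
  first inequality survives; the second holds because \<open>s *\<^sub>R v + r\<close> is a convex
  combination of \<open>v + r\<close> and \<open>r\<close>.\<close>

lemma metric_GL_ball:
  assumes GL: "metric_GL V N" and x: "x \<in> V" "N x = 1" and y: "y \<in> V" "N y \<le> 1" and e: "\<epsilon> > 0"
  obtains z w where "z \<in> V" "N z \<le> 1" "w \<in> V" "N w \<le> 1"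
    "N (x + z + w) > 3 - \<epsilon>" "N (y - z) + N (y + w) < 2 + \<epsilon>"
proof (cases "y = 0")
  case True
  obtain z w where zw: "z \<in> V" "N z \<le> 1" "w \<in> V" "N w \<le> 1" "N (x + z + w) > 3 - \<epsilon>"
    using metric_GLD[OF GL x x e] by blast
  then show ?thesis
    using that[OF zw] True norm_minus[of z] e by simp
next
  case False
  define s v where "s = N y" and "v = (1 / N y) *\<^sub>R y"
  have s: "0 < s" "s \<le> 1" and yv: "y = s *\<^sub>R v"
    using norm_pos[OF y(1) False] y(2) by (auto simp: s_def v_def)
  have v: "v \<in> V" "N v = 1"
    using y norm_normalized[OF y(1) False] by (auto simp: v_def)
  have "\<epsilon> / 2 > 0" using e by simp
  then obtain z w where zw: "z \<in> V" "N z \<le> 1" "w \<in> V" "N w \<le> 1" "N (x + z + w) > 3 - \<epsilon> / 2"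
      "N (v - z) + N (v + w) < 2 + \<epsilon> / 2"
    using metric_GLD[OF GL x v] by blast
  have convex: "N (s *\<^sub>R v + r) \<le> s * N (v + r) + (1 - s)" if r: "r \<in> V" "N r \<le> 1" for r
  proof -
    have "N (s *\<^sub>R (v + r) + (1 - s) *\<^sub>R r) \<le> s * N (v + r) + (1 - s) * N r"
      using norm_triangle[of "s *\<^sub>R (v + r)" "(1 - s) *\<^sub>R r"] norm_scale[of "v + r" s]
        norm_scale[of r "1 - s"] s r v by simp
    also have "(1 - s) * N r \<le> (1 - s) * 1"
      using s r by (intro mult_left_mono) auto
    finally show ?thesis by (simp add: algebra_simps)
  qed
  have "N (y - z) + N (y + w) \<le> s * (N (v - z) + N (v + w)) + 2 * (1 - s)"
    using convex[of "- z"] convex[of w] zw norm_minus[of z] by (simp add: yv algebra_simps)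
  also have "s * (N (v - z) + N (v + w)) \<le> s * (2 + \<epsilon> / 2)"
    using zw(6) s by (intro mult_left_mono) auto
  also have "s * (2 + \<epsilon> / 2) + 2 * (1 - s) < 2 + \<epsilon>"
    using mult_right_mono[of s 1 "\<epsilon> / 2"] s e by (simp add: algebra_simps)
  finally show ?thesis
    using that[OF zw(1-4)] zw(5) e by simp
qed

text \<open>Made for the l1-sum, where coordinates have arbitrary norms: all bounds are linear in
  \<open>N x\<close> and \<open>N y\<close> and can be summed over the coordinates.\<close>

lemma metric_GL_homogeneous:
  assumes GL: "metric_GL V N" and x: "x \<in> V" and y: "y \<in> V" and e: "\<epsilon> > 0"
  shows "\<exists>z w. z \<in> V \<and> w \<in> V \<and> N z \<le> N y \<and> N w \<le> N y \<and>
    N (x + z + w) \<ge> N x + 2 * N y - \<epsilon> * (N x + N y) \<and> N (y - z) + N (y + w) \<le> (2 + \<epsilon>) * N y"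
proof (cases "y = 0")
  case True
  then show ?thesis
    using x norm_ge_0[OF x] e by (intro exI[of _ 0]) auto
next
  case False
  define a b where "a = N x" and "b = N y"
  define v where "v = (1 / b) *\<^sub>R y"
  \<comment> \<open>For \<open>x = 0\<close> any unit vector will do, since it is multiplied by
    \<open>a = 0\<close>.\<close>
  define u where "u = (if x = 0 then v else (1 / a) *\<^sub>R x)"
  have b: "b > 0" and a: "a \<ge> 0" using norm_pos[OF y False] norm_ge_0[OF x] by (auto simp: a_def b_def)
  have v: "v \<in> V" "N v = 1" "y = b *\<^sub>R v"
    using y norm_normalized[OF y False] b by (auto simp: v_def b_def)
  have u: "u \<in> V" "N u = 1" "x = a *\<^sub>R u"
    using x v norm_normalized[OF x] norm_pos[OF x] norm_eq_0_iff[OF x] by (auto simp: u_def a_def)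
  obtain z w where zw: "z \<in> V" "N z \<le> 1" "w \<in> V" "N w \<le> 1" "N (u + z + w) > 3 - \<epsilon>"
      "N (v - z) + N (v + w) < 2 + \<epsilon>"
    using metric_GLD[OF GL u(1,2) v(1,2) e] by blast
  \<comment> \<open>The known bound concerns \<open>u + z + w\<close> with equal weights. Scaling it
    by the largest weight \<open>m\<close> and removing the surplus \<open>r\<close>, of norm at
    most \<open>(m - a) + 2 * (m - b)\<close>, leaves \<open>a + 2 * b\<close> up to the error
    \<epsilon> * \<open>m\<close>.\<close>
  define m where "m = max a b"
  have m: "a \<le> m" "b \<le> m" "m \<le> a + b" "0 \<le> m" using a b by (auto simp: m_def)
  define r where "r = (m - a) *\<^sub>R u + ((m - b) *\<^sub>R z + (m - b) *\<^sub>R w)"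
  have rV: "r \<in> V" using u zw by (simp add: r_def)
  have bounds: "(m - b) * N z \<le> m - b" "(m - b) * N w \<le> m - b"
    using mult_left_mono[of "N z" 1 "m - b"] mult_left_mono[of "N w" 1 "m - b"] m zw by auto
  have "N r \<le> N ((m - a) *\<^sub>R u) + (N ((m - b) *\<^sub>R z) + N ((m - b) *\<^sub>R w))"
    unfolding r_def using u zw by (intro order_trans[OF norm_triangle] add_mono norm_triangle order_refl) auto
  also have "\<dots> \<le> (m - a) + 2 * (m - b)"
    using norm_scale u zw m bounds by simp
  finally have r: "N r \<le> 3 * m - a - 2 * b" by simp
  have eq: "x + b *\<^sub>R z + b *\<^sub>R w = m *\<^sub>R (u + z + w) - r"
    unfolding r_def u(3) by (simp add: algebra_simps)
  have "m * (3 - \<epsilon>) \<le> m * N (u + z + w)"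
    using zw(5) m by (intro mult_left_mono) auto
  then have "m * (3 - \<epsilon>) - N r \<le> N (x + b *\<^sub>R z + b *\<^sub>R w)"
    unfolding eq using norm_triangle_sub[of "m *\<^sub>R (u + z + w)" r]
      norm_scale[of "u + z + w" m] rV u zw m by simp
  moreover have "\<epsilon> * m \<le> \<epsilon> * (a + b)"
    using m(3) e by (intro mult_left_mono) auto
  ultimately have lower: "a + 2 * b - \<epsilon> * (a + b) \<le> N (x + b *\<^sub>R z + b *\<^sub>R w)"
    using r by (simp add: algebra_simps)
  have "N (y - b *\<^sub>R z) + N (y + b *\<^sub>R w) = b * (N (v - z) + N (v + w))"
    using norm_scale[of "v - z" b] norm_scale[of "v + w" b] v zw b
    by (simp add: scaleR_diff_right scaleR_add_right distrib_left)
  also have "\<dots> \<le> b * (2 + \<epsilon>)"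
    using zw(6) b by (intro mult_left_mono) auto
  finally have "N (y - b *\<^sub>R z) + N (y + b *\<^sub>R w) \<le> (2 + \<epsilon>) * b" by (simp add: mult.commute)
  moreover have "N (b *\<^sub>R z) \<le> b" "N (b *\<^sub>R w) \<le> b"
    using norm_scale[of z b] norm_scale[of w b] zw b by (auto simp: mult_left_le)
  ultimately show ?thesis
    using lower zw unfolding a_def b_def by blast
qed

text \<open>
  In the \<open>l\<^sub>1\<close>-sum the parts of \<open>z\<close> and \<open>w\<close> outside the summand of \<open>x\<close> and \<open>y\<close> have norms \<open>b\<close> and
  \<open>c\<close>. Replacing these parts by multiples of \<open>x\<close> costs nothing in the second inequality by the
  triangle inequality, and almost nothing in the first by convexity of \<open>t \<mapsto> N (t x + z + w)\<close>.
\<close>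

lemma absorb_remainder:
  assumes x: "x \<in> V" "N x = 1" and y: "y \<in> V" and zw: "z \<in> V" "w \<in> V"
    and b: "0 \<le> b" "N z + b \<le> 1" and c: "0 \<le> c" "N w + c \<le> 1" and e: "\<epsilon> > 0"
    and sum: "N (x + z + w) + b + c > 3 - \<epsilon>" and diff: "N (y - z) + b + N (y + w) + c < 2 + \<epsilon>"
  shows "N (z + b *\<^sub>R x) \<le> 1" "N (w + c *\<^sub>R x) \<le> 1"
    "N (x + (z + b *\<^sub>R x) + (w + c *\<^sub>R x)) > 3 - 3 * \<epsilon>"
    "N (y - (z + b *\<^sub>R x)) + N (y + (w + c *\<^sub>R x)) < 2 + \<epsilon>"
proof -
  have bx: "N (b *\<^sub>R x) = b" "N (c *\<^sub>R x) = c" using norm_scale[of x] x b c by auto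
  show "N (z + b *\<^sub>R x) \<le> 1" "N (w + c *\<^sub>R x) \<le> 1"
    using norm_triangle[of z "b *\<^sub>R x"] norm_triangle[of w "c *\<^sub>R x"] bx b c x zw by auto
  have "N (y - (z + b *\<^sub>R x)) \<le> N (y - z) + b" "N (y + (w + c *\<^sub>R x)) \<le> N (y + w) + c"
    using norm_diff_triangle[of "y - z" "b *\<^sub>R x"] norm_triangle[of "y + w" "c *\<^sub>R x"] bx x y zw
    by (auto simp: algebra_simps)
  then show "N (y - (z + b *\<^sub>R x)) + N (y + (w + c *\<^sub>R x)) < 2 + \<epsilon>"
    using diff by simp
  define \<beta> where "\<beta> = b + c"
  have \<beta>: "0 \<le> \<beta>" "\<beta> \<le> 2"
    using b c norm_ge_0[OF zw(1)] norm_ge_0[OF zw(2)] by (auto simp: \<beta>_def)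
  define p where "p = x + (z + b *\<^sub>R x) + (w + c *\<^sub>R x)"
  have pV: "p \<in> V" using x zw by (simp add: p_def)
  \<comment> \<open>Convexity in cleared form: \<open>x + z + w\<close> lies between
    \<open>p\<close> and \<open>z + w\<close>, and the latter has norm at most
    \<open>2 - \<beta>\<close>. As \<beta> is at most 2, the error \<epsilon> + \<beta> * \<epsilon>
    is at most 3 * \<epsilon>.\<close>
  have "(1 + \<beta>) *\<^sub>R (x + z + w) = p + \<beta> *\<^sub>R (z + w)"
    by (simp add: p_def \<beta>_def algebra_simps)
  then have "(1 + \<beta>) * N (x + z + w) \<le> N p + \<beta> * N (z + w)"
    using norm_triangle[OF pV, of "\<beta> *\<^sub>R (z + w)"] norm_scale[of "x + z + w" "1 + \<beta>"]
      norm_scale[of "z + w" \<beta>] \<beta> x zw by simp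
  moreover have "\<beta> * N (z + w) \<le> \<beta> * (2 - \<beta>)"
    using norm_triangle[OF zw] b c \<beta> by (intro mult_left_mono) (auto simp: \<beta>_def)
  moreover have "(1 + \<beta>) * (3 - \<epsilon> - \<beta>) < (1 + \<beta>) * N (x + z + w)"
    using sum \<beta> by (intro mult_strict_left_mono) (auto simp: \<beta>_def)
  moreover have "(1 + \<beta>) * (3 - \<epsilon> - \<beta>) - \<beta> * (2 - \<beta>) = 3 - \<epsilon> - \<beta> * \<epsilon>"
    by (simp add: algebra_simps)
  moreover have "\<beta> * \<epsilon> \<le> 2 * \<epsilon>"
    using \<beta> e by (intro mult_right_mono) auto
  ultimately show "N (x + (z + b *\<^sub>R x) + (w + c *\<^sub>R x)) > 3 - 3 * \<epsilon>"
    unfolding p_def[symmetric] by linarith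
qed

end

section \<open>Sums of Banach spaces\<close>

locale banach_family =
  fixes \<Lambda> :: "'i set" and E :: "'i \<Rightarrow> 'a::real_vector set" and N :: "'i \<Rightarrow> 'a \<Rightarrow> real"
  assumes banach: "\<And>i. i \<in> \<Lambda> \<Longrightarrow> banach_space_on (E i) (N i)"
begin

lemma member: "i \<in> \<Lambda> \<Longrightarrow> normed_on (E i) (N i)"
  using banach by unfold_locales (auto simp: banach_space_on_def)

lemmas member_mem [simp] = normed_on.mem[OF member]
lemmas member_norm_ge_0 = normed_on.norm_ge_0[OF member]
lemmas member_norm_0 [simp] = normed_on.norm_0[OF member]
lemmas member_norm_eq_0_iff = normed_on.norm_eq_0_iff[OF member]
lemmas member_norm_scale = normed_on.norm_scale[OF member]
lemmas member_norm_triangle = normed_on.norm_triangle[OF member]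
lemmas member_norm_triangle_sub = normed_on.norm_triangle_sub[OF member]
lemmas member_norm_minus = normed_on.norm_minus[OF member]
lemmas member_norm_minus_commute = normed_on.norm_minus_commute[OF member]

lemma family_mem: "x \<in> family_space \<Lambda> E \<Longrightarrow> i \<in> \<Lambda> \<Longrightarrow> x i \<in> E i"
  by (simp add: family_space_def)

lemma subspace_family_space: "subspace (family_space \<Lambda> E)"
  by (auto simp: subspace_def family_space_def)

lemma fun_upd_family: "x \<in> family_space \<Lambda> E \<Longrightarrow> i \<in> \<Lambda> \<Longrightarrow> a \<in> E i \<Longrightarrow> x(i := a) \<in> family_space \<Lambda> E"
  by (auto simp: family_space_def)

lemma tendsto_member_norm:
  assumes i: "i \<in> \<Lambda>" and s: "\<And>n. s n \<in> E i" and x: "x \<in> E i"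
    and lim: "(\<lambda>n. N i (s n - x)) \<longlonglongrightarrow> 0"
  shows "(\<lambda>n. N i (s n)) \<longlonglongrightarrow> N i x"
proof -
  have "norm (N i (s n) - N i x) \<le> norm (N i (s n - x)) * 1" for n
    using member_norm_triangle_sub[OF i s x, of n] member_norm_triangle_sub[OF i x s, of n]
      member_norm_minus_commute[OF i x s, of n] by simp
  then have "(\<lambda>n. N i (s n) - N i x) \<longlonglongrightarrow> 0"
    by (intro tendsto_0_le[OF lim] always_eventually allI)
  then show ?thesis by (rule LIM_zero_cancel)
qed

text \<open>One completeness proof for both sums. Coordinates converge by completeness of the
  members; \<open>closed\<close> puts the coordinatewise limit into \<open>S\<close>, and
  \<open>lower\<close>, lower semicontinuity of \<open>M\<close>, upgrades coordinatewise
  convergence of a Cauchy sequence to convergence in \<open>M\<close>.\<close>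

lemma banach_space_on_sum:
  assumes normed: "normed_space_on S M" and fam: "S \<subseteq> family_space \<Lambda> E"
    and coord: "\<And>x i. x \<in> S \<Longrightarrow> i \<in> \<Lambda> \<Longrightarrow> N i (x i) \<le> M x"
    and closed: "\<And>s x. (\<And>n::nat. s n \<in> S) \<Longrightarrow> \<forall>\<epsilon>>0. \<exists>K. \<forall>m\<ge>K. \<forall>n\<ge>K. M (s m - s n) < \<epsilon> \<Longrightarrow>
      x \<in> family_space \<Lambda> E \<Longrightarrow> (\<And>i. i \<in> \<Lambda> \<Longrightarrow> (\<lambda>n. N i (s n i - x i)) \<longlonglongrightarrow> 0) \<Longrightarrow> x \<in> S"
    and lower: "\<And>s x B. (\<And>n::nat. s n \<in> S) \<Longrightarrow> x \<in> S \<Longrightarrow>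
      (\<And>i. i \<in> \<Lambda> \<Longrightarrow> (\<lambda>n. N i (s n i - x i)) \<longlonglongrightarrow> 0) \<Longrightarrow> (\<And>n. M (s n) \<le> B) \<Longrightarrow> M x \<le> B"
  shows "banach_space_on S M"
proof -
  interpret S: normed_on S M by unfold_locales (rule normed)
  have "S.mcomplete"
    unfolding S.mcomplete_iff
  proof (intro allI impI)
    fix s :: "nat \<Rightarrow> 'i \<Rightarrow> 'a"
    assume "\<forall>n. s n \<in> S" and Cauchy: "\<forall>\<epsilon>>0. \<exists>K. \<forall>m\<ge>K. \<forall>n\<ge>K. M (s m - s n) < \<epsilon>"
    then have s: "\<And>n. s n \<in> S" by simp
    have sE: "s n i \<in> E i" if "i \<in> \<Lambda>" for n i
      using s fam family_mem that by blast
    have "\<exists>a\<in>E i. (\<lambda>n. N i (s n i - a)) \<longlonglongrightarrow> 0" if i: "i \<in> \<Lambda>" for i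
    proof -
      interpret Ei: normed_on "E i" "N i" using i by (rule member)
      have "\<forall>\<epsilon>>0. \<exists>K. \<forall>m\<ge>K. \<forall>n\<ge>K. N i (s m i - s n i) < \<epsilon>"
      proof (intro allI impI)
        fix \<epsilon> :: real assume "\<epsilon> > 0"
        then obtain K where "\<forall>m\<ge>K. \<forall>n\<ge>K. M (s m - s n) < \<epsilon>" using Cauchy by blast
        moreover have "N i (s m i - s n i) \<le> M (s m - s n)" for m n
          using coord[of "s m - s n" i] s i by simp
        ultimately show "\<exists>K. \<forall>m\<ge>K. \<forall>n\<ge>K. N i (s m i - s n i) < \<epsilon>"
          by (meson le_less_trans)
      qed
      moreover have "Ei.mcomplete" using banach[OF i] by (simp add: banach_space_on_def)
      moreover have "\<forall>n. s n i \<in> E i" using sE i by blast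
      ultimately have "\<exists>a\<in>E i. \<forall>\<epsilon>>0. \<exists>K. \<forall>n\<ge>K. N i (s n i - a) < \<epsilon>"
        unfolding Ei.mcomplete_iff by simp
      then obtain a where "a \<in> E i" "\<forall>\<epsilon>>0. \<exists>K. \<forall>n\<ge>K. N i (s n i - a) < \<epsilon>" by blast
      then show ?thesis
        using sE i Ei.norm_ge_0 by (intro bexI[of _ a]) (auto simp: lim_sequentially dist_real_def)
    qed
    then obtain x' where x': "\<And>i. i \<in> \<Lambda> \<Longrightarrow> x' i \<in> E i" "\<And>i. i \<in> \<Lambda> \<Longrightarrow> (\<lambda>n. N i (s n i - x' i)) \<longlonglongrightarrow> 0"
      by metis
    define x where "x = (\<lambda>i. if i \<in> \<Lambda> then x' i else 0)"
    have xF: "x \<in> family_space \<Lambda> E" using x' by (auto simp: x_def family_space_def)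
    have lim: "(\<lambda>n. N i (s n i - x i)) \<longlonglongrightarrow> 0" if "i \<in> \<Lambda>" for i
      using x'(2)[OF that] that by (simp add: x_def)
    have xS: "x \<in> S" by (rule closed[OF s Cauchy xF lim])
    show "\<exists>x\<in>S. \<forall>\<epsilon>>0. \<exists>K. \<forall>n\<ge>K. M (s n - x) < \<epsilon>"
    proof (intro bexI[OF _ xS] allI impI)
      fix \<epsilon> :: real assume e: "\<epsilon> > 0"
      then obtain K where K: "\<forall>m\<ge>K. \<forall>n\<ge>K. M (s m - s n) < \<epsilon> / 2" using Cauchy half_gt_zero by blast
      \<comment> \<open>With \<open>n\<close> fixed, \<open>s n - s (m + K)\<close> tends to
        \<open>s n - x\<close> in each coordinate; the shift by \<open>K\<close> makes the Cauchy
        bound hold for every \<open>m\<close>.\<close>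
      have "M (s n - x) \<le> \<epsilon> / 2" if n: "n \<ge> K" for n
      proof (rule lower[of "\<lambda>m. s n - s (m + K)"])
        show "s n - s (m + K) \<in> S" for m using s by simp
        show "s n - x \<in> S" using s xS by simp
        show "M (s n - s (m + K)) \<le> \<epsilon> / 2" for m using K n by (simp add: less_imp_le)
        fix i assume i: "i \<in> \<Lambda>"
        have "(\<lambda>m. N i (s (m + K) i - x i)) \<longlonglongrightarrow> 0"
          using lim[OF i] by (rule LIMSEQ_ignore_initial_segment)
        moreover have "N i ((s n - s (m + K)) i - (s n - x) i) = N i (s (m + K) i - x i)" for m
          using member_norm_minus_commute[OF i sE[OF i] family_mem[OF xF i]] by simp
        ultimately show "(\<lambda>m. N i ((s n - s (m + K)) i - (s n - x) i)) \<longlonglongrightarrow> 0" by simp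
      qed
      then show "\<exists>K. \<forall>n\<ge>K. M (s n - x) < \<epsilon>"
        using e by (intro exI[of _ K]) (auto intro: le_less_trans[of _ "\<epsilon> / 2"])
    qed
  qed
  then show ?thesis using normed by (simp add: banach_space_on_def)
qed

section \<open>The c0-sum\<close>

lemma c0_norm_le: "B \<ge> 0 \<Longrightarrow> (\<And>i. i \<in> \<Lambda> \<Longrightarrow> N i (x i) \<le> B) \<Longrightarrow> c0_norm \<Lambda> N x \<le> B"
  unfolding c0_norm_def by (rule cSup_least) auto

lemma c0_sum_family: "x \<in> c0_sum \<Lambda> E N \<Longrightarrow> x \<in> family_space \<Lambda> E"
  by (simp add: c0_sum_def)

lemma c0_bdd:
  assumes x: "x \<in> c0_sum \<Lambda> E N"
  shows "bdd_above (insert 0 ((\<lambda>i. N i (x i)) ` \<Lambda>))"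
proof -
  define F where "F = {i \<in> \<Lambda>. N i (x i) \<ge> 1}"
  have F: "finite F" using x by (simp add: c0_sum_def F_def)
  have nonneg: "0 \<le> N i (x i)" if "i \<in> \<Lambda>" for i
    using member_norm_ge_0 that c0_sum_family[OF x] family_mem by blast
  have sum: "0 \<le> (\<Sum>j\<in>F. N j (x j))" using nonneg by (intro sum_nonneg) (auto simp: F_def)
  have "N i (x i) \<le> 1 + (\<Sum>j\<in>F. N j (x j))" if i: "i \<in> \<Lambda>" for i
  proof (cases "i \<in> F")
    case True
    then have "N i (x i) \<le> (\<Sum>j\<in>F. N j (x j))"
      using F nonneg by (intro member_le_sum) (auto simp: F_def)
    then show ?thesis by simp
  next
    case False
    then show ?thesis using i sum by (auto simp: F_def)
  qed
  then show ?thesis using sum by (intro bdd_aboveI[of _ "1 + (\<Sum>j\<in>F. N j (x j))"]) auto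
qed

lemma c0_norm_upper: "x \<in> c0_sum \<Lambda> E N \<Longrightarrow> i \<in> \<Lambda> \<Longrightarrow> N i (x i) \<le> c0_norm \<Lambda> N x"
  unfolding c0_norm_def by (rule cSup_upper[OF _ c0_bdd]) auto

lemma c0_norm_nonneg: "x \<in> c0_sum \<Lambda> E N \<Longrightarrow> 0 \<le> c0_norm \<Lambda> N x"
  unfolding c0_norm_def by (rule cSup_upper[OF _ c0_bdd]) auto

lemma c0_sumI:
  assumes "x \<in> family_space \<Lambda> E"
    and "\<And>\<epsilon>. \<epsilon> > 0 \<Longrightarrow> \<exists>F. finite F \<and> (\<forall>i\<in>\<Lambda>. N i (x i) \<ge> \<epsilon> \<longrightarrow> i \<in> F)"
  shows "x \<in> c0_sum \<Lambda> E N"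
  unfolding c0_sum_def
proof (intro CollectI conjI allI impI assms(1))
  fix \<epsilon> :: real assume "\<epsilon> > 0"
  then obtain F where "finite F" "\<forall>i\<in>\<Lambda>. N i (x i) \<ge> \<epsilon> \<longrightarrow> i \<in> F" using assms(2) by blast
  then show "finite {i \<in> \<Lambda>. \<epsilon> \<le> N i (x i)}" by (elim finite_subset[rotated]) auto
qed

lemma c0_sumD: "x \<in> c0_sum \<Lambda> E N \<Longrightarrow> \<epsilon> > 0 \<Longrightarrow> finite {i \<in> \<Lambda>. N i (x i) \<ge> \<epsilon>}"
  by (simp add: c0_sum_def)

lemma subspace_c0_sum: "subspace (c0_sum \<Lambda> E N)"
proof (rule subspaceI)
  show "0 \<in> c0_sum \<Lambda> E N"
    using subspace_0[OF subspace_family_space] by (intro c0_sumI) auto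
next
  fix x y assume x: "x \<in> c0_sum \<Lambda> E N" and y: "y \<in> c0_sum \<Lambda> E N"
  note F = x[THEN c0_sum_family] y[THEN c0_sum_family]
  show "x + y \<in> c0_sum \<Lambda> E N"
  proof (rule c0_sumI)
    show "x + y \<in> family_space \<Lambda> E" using F by (intro subspace_add[OF subspace_family_space])
    fix \<epsilon> :: real assume "\<epsilon> > 0"
    then have "finite ({i \<in> \<Lambda>. N i (x i) \<ge> \<epsilon> / 2} \<union> {i \<in> \<Lambda>. N i (y i) \<ge> \<epsilon> / 2})"
      using x y by (intro finite_UnI c0_sumD) auto
    moreover have "N i (x i) \<ge> \<epsilon> / 2 \<or> N i (y i) \<ge> \<epsilon> / 2" if "i \<in> \<Lambda>" "N i ((x + y) i) \<ge> \<epsilon>" for i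
      using member_norm_triangle[OF that(1), of "x i" "y i"] family_mem[OF F(1) that(1)]
        family_mem[OF F(2) that(1)] that(2) by auto
    ultimately show "\<exists>F. finite F \<and> (\<forall>i\<in>\<Lambda>. N i ((x + y) i) \<ge> \<epsilon> \<longrightarrow> i \<in> F)" by blast
  qed
next
  fix c x assume x: "x \<in> c0_sum \<Lambda> E N"
  note F = x[THEN c0_sum_family]
  show "c *\<^sub>R x \<in> c0_sum \<Lambda> E N"
  proof (rule c0_sumI)
    show "c *\<^sub>R x \<in> family_space \<Lambda> E" using F by (intro subspace_scale[OF subspace_family_space])
    fix \<epsilon> :: real assume e: "\<epsilon> > 0"
    then have "finite {i \<in> \<Lambda>. N i (x i) \<ge> \<epsilon> / (\<bar>c\<bar> + 1)}"
      using c0_sumD x by simp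
    moreover have "N i (x i) \<ge> \<epsilon> / (\<bar>c\<bar> + 1)" if i: "i \<in> \<Lambda>" "N i ((c *\<^sub>R x) i) \<ge> \<epsilon>" for i
    proof -
      have "\<epsilon> \<le> \<bar>c\<bar> * N i (x i)" using i member_norm_scale[OF i(1) family_mem[OF F i(1)]] by simp
      also have "\<dots> \<le> (\<bar>c\<bar> + 1) * N i (x i)"
        using member_norm_ge_0[OF i(1) family_mem[OF F i(1)]] by (intro mult_right_mono) auto
      finally show ?thesis by (simp add: divide_le_eq mult.commute add_pos_nonneg)
    qed
    ultimately show "\<exists>F. finite F \<and> (\<forall>i\<in>\<Lambda>. N i ((c *\<^sub>R x) i) \<ge> \<epsilon> \<longrightarrow> i \<in> F)" by blast
  qed
qed

lemma normed_c0_sum: "normed_space_on (c0_sum \<Lambda> E N) (c0_norm \<Lambda> N)"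
  unfolding normed_space_on_def
proof (intro conjI ballI allI)
  let ?S = "c0_sum \<Lambda> E N" and ?M = "c0_norm \<Lambda> N"
  show "subspace ?S" by (rule subspace_c0_sum)
  show "0 \<le> ?M x" if "x \<in> ?S" for x using that by (rule c0_norm_nonneg)
  show "?M x = 0 \<longleftrightarrow> x = 0" if x: "x \<in> ?S" for x
  proof
    assume 0: "?M x = 0"
    show "x = 0"
    proof
      fix i show "x i = 0 i"
      proof (cases "i \<in> \<Lambda>")
        case True
        then have "x i \<in> E i" using x c0_sum_family family_mem by blast
        then show ?thesis
          using c0_norm_upper[OF x True] 0 member_norm_ge_0[OF True] member_norm_eq_0_iff[OF True]
          by (metis order_antisym zero_fun_apply)
      next
        case False
        then show ?thesis using c0_sum_family[OF x] by (simp add: family_space_def)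
      qed
    qed
  next
    assume "x = 0"
    then show "?M x = 0"
      using c0_norm_le[of 0 x] c0_norm_nonneg[OF x] by simp
  qed
  have scale_le: "?M (c *\<^sub>R x) \<le> \<bar>c\<bar> * ?M x" if x: "x \<in> ?S" for c x
  proof (rule c0_norm_le)
    show "0 \<le> \<bar>c\<bar> * ?M x" using c0_norm_nonneg[OF x] by simp
    show "N i ((c *\<^sub>R x) i) \<le> \<bar>c\<bar> * ?M x" if i: "i \<in> \<Lambda>" for i
      using member_norm_scale[OF i family_mem[OF c0_sum_family[OF x] i]] c0_norm_upper[OF x i]
      by (simp add: mult_left_mono)
  qed
  show "?M (c *\<^sub>R x) = \<bar>c\<bar> * ?M x" if x: "x \<in> ?S" for c x
  proof (cases "c = 0")
    case True
    then show ?thesis using scale_le[OF x, of c] c0_norm_nonneg[OF subspace_0[OF subspace_c0_sum]] by simp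
  next
    case False
    have "\<bar>c\<bar> * ?M x \<le> \<bar>c\<bar> * (\<bar>inverse c\<bar> * ?M (c *\<^sub>R x))"
      using scale_le[OF subspace_scale[OF subspace_c0_sum x], of "inverse c" c] False
      by (intro mult_left_mono) auto
    also have "\<dots> = ?M (c *\<^sub>R x)" using False by simp
    finally show ?thesis using scale_le[OF x, of c] by simp
  qed
  show "?M (x + y) \<le> ?M x + ?M y" if x: "x \<in> ?S" and y: "y \<in> ?S" for x y
  proof (rule c0_norm_le)
    show "0 \<le> ?M x + ?M y" using c0_norm_nonneg x y by simp
    show "N i ((x + y) i) \<le> ?M x + ?M y" if i: "i \<in> \<Lambda>" for i
      using member_norm_triangle[OF i family_mem[OF c0_sum_family[OF x] i] family_mem[OF c0_sum_family[OF y] i]]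
        c0_norm_upper[OF x i] c0_norm_upper[OF y i] by simp
  qed
qed

lemma banach_c0_sum: "banach_space_on (c0_sum \<Lambda> E N) (c0_norm \<Lambda> N)"
proof (rule banach_space_on_sum[OF normed_c0_sum])
  interpret S: normed_on "c0_sum \<Lambda> E N" "c0_norm \<Lambda> N" by unfold_locales (rule normed_c0_sum)
  show "c0_sum \<Lambda> E N \<subseteq> family_space \<Lambda> E" by (auto simp: c0_sum_def)
  show "N i (x i) \<le> c0_norm \<Lambda> N x" if "x \<in> c0_sum \<Lambda> E N" "i \<in> \<Lambda>" for x i
    using that by (rule c0_norm_upper)
  have coord_le: "N i (x i) \<le> B" if s: "\<And>n. s n \<in> c0_sum \<Lambda> E N" "x \<in> family_space \<Lambda> E" "i \<in> \<Lambda>"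
    "(\<lambda>n. N i (s n i - x i)) \<longlonglongrightarrow> 0" "\<And>n. c0_norm \<Lambda> N (s n) \<le> B" for s x B i
  proof (rule LIMSEQ_le_const2)
    show "(\<lambda>n. N i (s n i)) \<longlonglongrightarrow> N i (x i)"
      using s c0_sum_family family_mem by (intro tendsto_member_norm) auto
    show "\<exists>N'. \<forall>n\<ge>N'. N i (s n i) \<le> B"
      using c0_norm_upper[OF s(1,3)] s(5) by (meson order_trans)
  qed
  show "c0_norm \<Lambda> N x \<le> B" if "\<And>n. s n \<in> c0_sum \<Lambda> E N" "x \<in> c0_sum \<Lambda> E N"
    "\<And>i. i \<in> \<Lambda> \<Longrightarrow> (\<lambda>n. N i (s n i - x i)) \<longlonglongrightarrow> 0" "\<And>n. c0_norm \<Lambda> N (s n) \<le> B" for s x B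
    using that coord_le[of s x _ B] c0_norm_nonneg[OF that(1)[of 0]] c0_sum_family
    by (intro c0_norm_le) (auto intro: order_trans)
  fix s x assume s: "\<And>n::nat. s n \<in> c0_sum \<Lambda> E N" and Cauchy: "\<forall>\<epsilon>>0. \<exists>K. \<forall>m\<ge>K. \<forall>n\<ge>K. c0_norm \<Lambda> N (s m - s n) < \<epsilon>"
    and x: "x \<in> family_space \<Lambda> E" and lim: "\<And>i. i \<in> \<Lambda> \<Longrightarrow> (\<lambda>n. N i (s n i - x i)) \<longlonglongrightarrow> 0"
  show "x \<in> c0_sum \<Lambda> E N"
  proof (rule c0_sumI[OF x])
    fix \<epsilon> :: real assume e: "\<epsilon> > 0"
    then obtain K where K: "\<forall>m\<ge>K. \<forall>n\<ge>K. c0_norm \<Lambda> N (s m - s n) < \<epsilon> / 2" using Cauchy half_gt_zero by blast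
    \<comment> \<open>The bound is uniform in \<open>i\<close>, so coordinates of \<open>x\<close>
      of norm at least \<epsilon> occur only among the finitely many where \<open>s K\<close> has
      norm at least \<epsilon> / 2.\<close>
    have le: "N i ((x - s K) i) \<le> \<epsilon> / 2" if i: "i \<in> \<Lambda>" for i
    proof (rule coord_le[of "\<lambda>m. s (m + K) - s K" "x - s K" i])
      show "x - s K \<in> family_space \<Lambda> E"
        using x c0_sum_family[OF s] by (intro subspace_diff[OF subspace_family_space])
      show "(\<lambda>m. N i ((s (m + K) - s K) i - (x - s K) i)) \<longlonglongrightarrow> 0"
        using LIMSEQ_ignore_initial_segment[OF lim[OF i], of K] by simp
      show "c0_norm \<Lambda> N (s (m + K) - s K) \<le> \<epsilon> / 2" for m using K by (simp add: less_imp_le)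
    qed (use s i in auto)
    have "finite {i \<in> \<Lambda>. N i (s K i) \<ge> \<epsilon> / 2}" using s e by (intro c0_sumD) auto
    moreover have "N i (s K i) \<ge> \<epsilon> / 2" if i: "i \<in> \<Lambda>" "N i (x i) \<ge> \<epsilon>" for i
      using member_norm_triangle_sub[OF i(1) family_mem[OF x i(1)] family_mem[OF c0_sum_family[OF s] i(1)], of K]
        le[OF i(1)] i(2) by simp
    ultimately show "\<exists>F. finite F \<and> (\<forall>i\<in>\<Lambda>. N i (x i) \<ge> \<epsilon> \<longrightarrow> i \<in> F)" by blast
  qed
qed

lemma c0_fun_upd:
  assumes x: "x \<in> c0_sum \<Lambda> E N" and i: "i \<in> \<Lambda>" and a: "a \<in> E i"
  shows "x(i := a) \<in> c0_sum \<Lambda> E N"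
proof (rule c0_sumI)
  show "x(i := a) \<in> family_space \<Lambda> E" using fun_upd_family[OF c0_sum_family[OF x] i a] .
  fix \<epsilon> :: real assume "\<epsilon> > 0"
  then have "finite (insert i {j \<in> \<Lambda>. N j (x j) \<ge> \<epsilon>})" using c0_sumD[OF x] by simp
  then show "\<exists>F. finite F \<and> (\<forall>j\<in>\<Lambda>. N j ((x(i := a)) j) \<ge> \<epsilon> \<longrightarrow> j \<in> F)"
    by (intro exI[of _ "insert i {j \<in> \<Lambda>. N j (x j) \<ge> \<epsilon>}"]) auto
qed

lemma c0_norm_single:
  assumes i: "i \<in> \<Lambda>" and a: "a \<in> E i"
  shows "0(i := a) \<in> c0_sum \<Lambda> E N" "c0_norm \<Lambda> N (0(i := a)) = N i a"
proof -
  show mem: "0(i := a) \<in> c0_sum \<Lambda> E N"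
    using subspace_0[OF subspace_c0_sum] i a by (rule c0_fun_upd)
  show "c0_norm \<Lambda> N (0(i := a)) = N i a"
    using c0_norm_upper[OF mem i] member_norm_ge_0[OF i a]
    by (intro antisym c0_norm_le) auto
qed

text \<open>Away from \<open>i\<close> the vector \<open>x\<close> vanishes and \<open>z + w\<close>
  has coordinates of norm at most 2, so a norm close to 3 can only come from coordinate
  \<open>i\<close>. Capping the tolerance at 1 keeps the threshold at 2 or above.\<close>

lemma metric_GL_c0_sumD:
  assumes GL: "metric_GL (c0_sum \<Lambda> E N) (c0_norm \<Lambda> N)" and i: "i \<in> \<Lambda>"
  shows "metric_GL (E i) (N i)"
  unfolding metric_GL_def
proof (intro ballI allI impI)
  interpret S: normed_on "c0_sum \<Lambda> E N" "c0_norm \<Lambda> N" by unfold_locales (rule normed_c0_sum)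
  fix x y and \<epsilon> :: real assume "x \<in> unit_sphere_on (E i) (N i)" "y \<in> unit_sphere_on (E i) (N i)" and e: "\<epsilon> > 0"
  then have x: "x \<in> E i" "N i x = 1" and y: "y \<in> E i" "N i y = 1" by (auto simp: unit_sphere_on_def)
  define \<eta> where "\<eta> = min 1 \<epsilon>"
  have \<eta>: "\<eta> > 0" "\<eta> \<le> 1" "\<eta> \<le> \<epsilon>" using e by (auto simp: \<eta>_def)
  obtain z w where zw: "z \<in> c0_sum \<Lambda> E N" "c0_norm \<Lambda> N z \<le> 1" "w \<in> c0_sum \<Lambda> E N" "c0_norm \<Lambda> N w \<le> 1"
    "c0_norm \<Lambda> N (0(i := x) + z + w) > 3 - \<eta>" "c0_norm \<Lambda> N (0(i := y) - z) + c0_norm \<Lambda> N (0(i := y) + w) < 2 + \<eta>"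
    using metric_GLD[OF GL, of "0(i := x)" "0(i := y)" \<eta>] c0_norm_single[OF i x(1)] c0_norm_single[OF i y(1)] x y \<eta>
    by metis
  have zE: "z j \<in> E j" "N j (z j) \<le> 1" and wE: "w j \<in> E j" "N j (w j) \<le> 1" if "j \<in> \<Lambda>" for j
    using that zw c0_sum_family family_mem c0_norm_upper by (blast intro: order_trans)+
  have "\<exists>j\<in>\<Lambda>. N j ((0(i := x) + z + w) j) > 3 - \<eta>"
  proof (rule ccontr)
    assume "\<not> ?thesis"
    then have "c0_norm \<Lambda> N (0(i := x) + z + w) \<le> 3 - \<eta>"
      using \<eta> by (intro c0_norm_le) (auto simp: not_less)
    then show False using zw(5) by simp
  qed
  then obtain j where j: "j \<in> \<Lambda>" "N j ((0(i := x) + z + w) j) > 3 - \<eta>" by blast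
  have "j = i"
  proof (rule ccontr)
    assume "j \<noteq> i"
    then have "N j ((0(i := x) + z + w) j) \<le> 2"
      using member_norm_triangle[OF j(1) zE(1) wE(1)] zE(2) wE(2) j(1) by fastforce
    then show False using j(2) \<eta> by simp
  qed
  then have "N i (x + z i + w i) > 3 - \<epsilon>" using j(2) \<eta> by simp
  moreover have "N i (y - z i) \<le> c0_norm \<Lambda> N (0(i := y) - z)" "N i (y + w i) \<le> c0_norm \<Lambda> N (0(i := y) + w)"
    using c0_norm_upper[of "0(i := y) - z" i] c0_norm_upper[of "0(i := y) + w" i] c0_norm_single[OF i y(1)] zw i
    by auto
  then have "N i (y - z i) + N i (y + w i) < 2 + \<epsilon>" using zw(6) \<eta> by simp
  ultimately show "\<exists>z\<in>unit_ball_on (E i) (N i). \<exists>w\<in>unit_ball_on (E i) (N i).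
      N i (x + z + w) > 3 - \<epsilon> \<and> N i (y - z) + N i (y + w) < 2 + \<epsilon>"
    using zE[OF i] wE[OF i] unfolding unit_ball_on_def by blast
qed

text \<open>One coordinate \<open>i\<close> where \<open>x\<close> is nearly of norm 1 suffices for
  the norm close to 3. In the others \<open>z = y\<close> and \<open>w = - y\<close> make both
  differences vanish, so the second inequality is also decided at \<open>i\<close>.\<close>

lemma metric_GL_c0_sumI:
  assumes GL: "\<And>i. i \<in> \<Lambda> \<Longrightarrow> metric_GL (E i) (N i)"
  shows "metric_GL (c0_sum \<Lambda> E N) (c0_norm \<Lambda> N)"
  unfolding metric_GL_def
proof (intro ballI allI impI)
  let ?S = "c0_sum \<Lambda> E N" and ?M = "c0_norm \<Lambda> N"
  interpret S: normed_on ?S ?M by unfold_locales (rule normed_c0_sum)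
  fix x y and \<epsilon> :: real assume "x \<in> unit_sphere_on ?S ?M" "y \<in> unit_sphere_on ?S ?M" and e: "\<epsilon> > 0"
  then have x: "x \<in> ?S" "?M x = 1" and y: "y \<in> ?S" "?M y = 1" by (auto simp: unit_sphere_on_def)
  \<comment> \<open>Spent twice: in the condition at coordinate \<open>i\<close> and in replacing
    \<open>x i\<close> by its normalization \<open>u\<close>. The bound 1/2 ensures
    \<open>x i \<noteq> 0\<close>.\<close>
  define \<eta> where "\<eta> = min (1 / 2) (\<epsilon> / 2)"
  have \<eta>: "\<eta> > 0" "\<eta> < 1" "2 * \<eta> \<le> \<epsilon>" using e by (auto simp: \<eta>_def)
  have "\<exists>i\<in>\<Lambda>. N i (x i) > 1 - \<eta>"
  proof (rule ccontr)
    assume "\<not> ?thesis"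
    then have "?M x \<le> 1 - \<eta>" using \<eta> by (intro c0_norm_le) (auto simp: not_less)
    then show False using x \<eta> by simp
  qed
  then obtain i where i: "i \<in> \<Lambda>" "N i (x i) > 1 - \<eta>" by blast
  interpret Ei: normed_on "E i" "N i" using i(1) by (rule member)
  have xi: "x i \<in> E i" "N i (x i) \<le> 1" and yi: "y i \<in> E i" "N i (y i) \<le> 1"
    using x y i(1) c0_sum_family family_mem c0_norm_upper by metis+
  have xi0: "x i \<noteq> 0" using i(2) \<eta> by auto
  define u where "u = (1 / N i (x i)) *\<^sub>R x i"
  have u: "u \<in> E i" "N i u = 1" using xi Ei.norm_normalized[OF xi(1) xi0] by (auto simp: u_def)
  have "x i = N i (x i) *\<^sub>R u" using Ei.norm_eq_0_iff[OF xi(1)] xi0 by (simp add: u_def)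
  then have "u - x i = (1 - N i (x i)) *\<^sub>R u" by (metis scaleR_left_diff_distrib scaleR_one)
  then have ux: "N i (u - x i) < \<eta>" using Ei.norm_scale[OF u(1), of "1 - N i (x i)"] u(2) i(2) xi(2) by simp
  obtain a b where ab: "a \<in> E i" "N i a \<le> 1" "b \<in> E i" "N i b \<le> 1" "N i (u + a + b) > 3 - \<eta>"
      "N i (y i - a) + N i (y i + b) < 2 + \<eta>"
    using Ei.metric_GL_ball[OF GL[OF i(1)] u yi \<eta>(1)] by blast
  define z w where "z = y(i := a)" and "w = (- y)(i := b)"
  have zw: "z \<in> ?S" "w \<in> ?S" using y ab i(1) by (auto simp: z_def w_def intro!: c0_fun_upd)
  have yj: "y j \<in> E j" "N j (y j) \<le> 1" if "j \<in> \<Lambda>" for j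
    using y that c0_sum_family family_mem c0_norm_upper by metis+
  have "?M z \<le> 1" "?M w \<le> 1"
    using ab yj by (auto simp: z_def w_def member_norm_minus intro!: c0_norm_le)
  moreover have "N i (u + a + b) \<le> N i (x i + a + b) + N i (u - x i)"
    using Ei.norm_triangle[of "x i + a + b" "u - x i"] xi u ab by (simp add: algebra_simps)
  then have "N i ((x + z + w) i) > 3 - \<epsilon>"
    using ab(5) ux \<eta>(3) by (simp add: z_def w_def)
  then have "?M (x + z + w) > 3 - \<epsilon>"
    using c0_norm_upper[OF _ i(1), of "x + z + w"] x zw by simp
  moreover have "?M (y - z) \<le> N i (y i - a)" "?M (y + w) \<le> N i (y i + b)"
    using Ei.norm_ge_0 yi ab by (auto simp: z_def w_def intro!: c0_norm_le)
  then have "?M (y - z) + ?M (y + w) < 2 + \<epsilon>" using ab(6) \<eta> by simp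
  ultimately show "\<exists>z\<in>unit_ball_on ?S ?M. \<exists>w\<in>unit_ball_on ?S ?M. ?M (x + z + w) > 3 - \<epsilon> \<and> ?M (y - z) + ?M (y + w) < 2 + \<epsilon>"
    using zw unfolding unit_ball_on_def by blast
qed

section \<open>The l1-sum\<close>

lemma l1_sum_family: "x \<in> l1_sum \<Lambda> E N \<Longrightarrow> x \<in> family_space \<Lambda> E"
  by (simp add: l1_sum_def)

lemma l1_summable: "x \<in> l1_sum \<Lambda> E N \<Longrightarrow> (\<lambda>i. N i (x i)) summable_on \<Lambda>"
  by (simp add: l1_sum_def)

lemma family_norm_ge_0: "x \<in> family_space \<Lambda> E \<Longrightarrow> i \<in> \<Lambda> \<Longrightarrow> 0 \<le> N i (x i)"
  using family_mem member_norm_ge_0 by blast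

lemma l1_sumI:
  assumes x: "x \<in> family_space \<Lambda> E" and f: "f summable_on \<Lambda>" and le: "\<And>i. i \<in> \<Lambda> \<Longrightarrow> N i (x i) \<le> f i"
  shows "x \<in> l1_sum \<Lambda> E N" "l1_norm \<Lambda> N x \<le> infsum f \<Lambda>"
proof -
  have "(\<lambda>i. N i (x i)) summable_on \<Lambda>"
    using f le family_norm_ge_0[OF x] by (rule summable_on_comparison_test)
  then show "x \<in> l1_sum \<Lambda> E N" "l1_norm \<Lambda> N x \<le> infsum f \<Lambda>"
    using x f le by (auto simp: l1_sum_def l1_norm_def intro!: infsum_mono)
qed

lemma l1_norm_nonneg: "x \<in> l1_sum \<Lambda> E N \<Longrightarrow> 0 \<le> l1_norm \<Lambda> N x"
  unfolding l1_norm_def using family_norm_ge_0[OF l1_sum_family] by (intro infsum_nonneg)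

lemma l1_norm_finite_upper:
  assumes x: "x \<in> l1_sum \<Lambda> E N" and F: "finite F" "F \<subseteq> \<Lambda>"
  shows "(\<Sum>i\<in>F. N i (x i)) \<le> l1_norm \<Lambda> N x"
  unfolding l1_norm_def using family_norm_ge_0[OF l1_sum_family[OF x]] F
  by (intro finite_sum_le_infsum l1_summable[OF x]) auto

lemma l1_norm_upper: "x \<in> l1_sum \<Lambda> E N \<Longrightarrow> i \<in> \<Lambda> \<Longrightarrow> N i (x i) \<le> l1_norm \<Lambda> N x"
  using l1_norm_finite_upper[of x "{i}"] by simp

lemma l1_sum_add:
  assumes x: "x \<in> l1_sum \<Lambda> E N" and y: "y \<in> l1_sum \<Lambda> E N"
  shows "x + y \<in> l1_sum \<Lambda> E N" "l1_norm \<Lambda> N (x + y) \<le> l1_norm \<Lambda> N x + l1_norm \<Lambda> N y"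
proof -
  note F = x[THEN l1_sum_family] y[THEN l1_sum_family]
  have xy: "x + y \<in> family_space \<Lambda> E" using F by (intro subspace_add[OF subspace_family_space])
  have summable: "(\<lambda>i. N i (x i) + N i (y i)) summable_on \<Lambda>"
    using x y by (intro summable_on_add l1_summable)
  have le: "N i ((x + y) i) \<le> N i (x i) + N i (y i)" if "i \<in> \<Lambda>" for i
    using member_norm_triangle[OF that family_mem[OF F(1) that] family_mem[OF F(2) that]] by simp
  show "x + y \<in> l1_sum \<Lambda> E N" using l1_sumI(1)[OF xy summable le] .
  show "l1_norm \<Lambda> N (x + y) \<le> l1_norm \<Lambda> N x + l1_norm \<Lambda> N y"
    using l1_sumI(2)[OF xy summable le] infsum_add[OF l1_summable[OF x] l1_summable[OF y]]
    by (simp add: l1_norm_def)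
qed

lemma l1_sum_scale:
  assumes x: "x \<in> l1_sum \<Lambda> E N"
  shows "c *\<^sub>R x \<in> l1_sum \<Lambda> E N" "l1_norm \<Lambda> N (c *\<^sub>R x) = \<bar>c\<bar> * l1_norm \<Lambda> N x"
proof -
  note F = x[THEN l1_sum_family]
  have eq: "N i ((c *\<^sub>R x) i) = \<bar>c\<bar> * N i (x i)" if "i \<in> \<Lambda>" for i
    using member_norm_scale[OF that family_mem[OF F that]] by simp
  show "c *\<^sub>R x \<in> l1_sum \<Lambda> E N"
    using summable_on_cmult_right[OF l1_summable[OF x], of "\<bar>c\<bar>"] eq F
    by (intro l1_sumI(1)[of _ "\<lambda>i. \<bar>c\<bar> * N i (x i)"] subspace_scale[OF subspace_family_space]) auto
  show "l1_norm \<Lambda> N (c *\<^sub>R x) = \<bar>c\<bar> * l1_norm \<Lambda> N x"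
    unfolding l1_norm_def infsum_cmult_right'[symmetric] using eq by (intro infsum_cong) simp
qed

lemma normed_l1_sum: "normed_space_on (l1_sum \<Lambda> E N) (l1_norm \<Lambda> N)"
  unfolding normed_space_on_def
proof (intro conjI ballI allI)
  let ?S = "l1_sum \<Lambda> E N" and ?M = "l1_norm \<Lambda> N"
  have zero: "N i ((0 :: 'i \<Rightarrow> 'a) i) = 0" if "i \<in> \<Lambda>" for i using that by simp
  have zero_mem: "0 \<in> ?S"
    using subspace_0[OF subspace_family_space] zero by (intro l1_sumI(1)[of _ "\<lambda>_. 0"]) auto
  show "subspace ?S" using zero_mem l1_sum_add(1) l1_sum_scale(1) by (intro subspaceI)
  show "0 \<le> ?M x" if "x \<in> ?S" for x using that by (rule l1_norm_nonneg)
  show "?M x = 0 \<longleftrightarrow> x = 0" if x: "x \<in> ?S" for x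
  proof
    assume 0: "?M x = 0"
    show "x = 0"
    proof
      fix i show "x i = 0 i"
      proof (cases "i \<in> \<Lambda>")
        case True
        then have "x i \<in> E i" using x l1_sum_family family_mem by blast
        then show ?thesis
          using l1_norm_upper[OF x True] 0 member_norm_ge_0[OF True] member_norm_eq_0_iff[OF True]
          by (metis order_antisym zero_fun_apply)
      next
        case False
        then show ?thesis using l1_sum_family[OF x] by (simp add: family_space_def)
      qed
    qed
  next
    assume "x = 0"
    then show "?M x = 0" using zero by (simp add: l1_norm_def infsum_0)
  qed
  show "?M (c *\<^sub>R x) = \<bar>c\<bar> * ?M x" if "x \<in> ?S" for c x using that by (rule l1_sum_scale)
  show "?M (x + y) \<le> ?M x + ?M y" if "x \<in> ?S" "y \<in> ?S" for x y using that by (rule l1_sum_add)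
qed

text \<open>Fatou's lemma for sums: finite partial sums pass to the limit and stay below
  \<open>B\<close>. This yields both membership of the limit and the bound on its norm.\<close>

lemma l1_norm_lower_semicontinuous:
  assumes s: "\<And>n::nat. s n \<in> l1_sum \<Lambda> E N" and x: "x \<in> family_space \<Lambda> E"
    and lim: "\<And>i. i \<in> \<Lambda> \<Longrightarrow> (\<lambda>n. N i (s n i - x i)) \<longlonglongrightarrow> 0"
    and le: "\<And>n. l1_norm \<Lambda> N (s n) \<le> B"
  shows "x \<in> l1_sum \<Lambda> E N" "l1_norm \<Lambda> N x \<le> B"
proof -
  have fin: "(\<Sum>i\<in>F. N i (x i)) \<le> B" if F: "finite F" "F \<subseteq> \<Lambda>" for F
  proof (rule LIMSEQ_le_const2)
    show "(\<lambda>n. \<Sum>i\<in>F. N i (s n i)) \<longlonglongrightarrow> (\<Sum>i\<in>F. N i (x i))"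
    proof (rule tendsto_sum)
      fix i assume "i \<in> F"
      then have i: "i \<in> \<Lambda>" using F by blast
      show "(\<lambda>n. N i (s n i)) \<longlonglongrightarrow> N i (x i)"
        using family_mem[OF l1_sum_family[OF s] i] family_mem[OF x i] lim[OF i]
        by (rule tendsto_member_norm[OF i])
    qed
    show "\<exists>K. \<forall>n\<ge>K. (\<Sum>i\<in>F. N i (s n i)) \<le> B"
      using l1_norm_finite_upper[OF s F] le by (meson order_trans)
  qed
  have summable: "(\<lambda>i. N i (x i)) summable_on \<Lambda>"
    using family_norm_ge_0[OF x] fin by (intro nonneg_bdd_above_summable_on bdd_aboveI[of _ B]) auto
  then show "x \<in> l1_sum \<Lambda> E N" using x by (simp add: l1_sum_def)
  show "l1_norm \<Lambda> N x \<le> B"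
    unfolding l1_norm_def using summable fin by (rule infsum_le_finite_sums)
qed

lemma banach_l1_sum: "banach_space_on (l1_sum \<Lambda> E N) (l1_norm \<Lambda> N)"
proof (rule banach_space_on_sum[OF normed_l1_sum])
  interpret S: normed_on "l1_sum \<Lambda> E N" "l1_norm \<Lambda> N" by unfold_locales (rule normed_l1_sum)
  show "l1_sum \<Lambda> E N \<subseteq> family_space \<Lambda> E" by (auto simp: l1_sum_def)
  show "N i (x i) \<le> l1_norm \<Lambda> N x" if "x \<in> l1_sum \<Lambda> E N" "i \<in> \<Lambda>" for x i
    using that by (rule l1_norm_upper)
  show "l1_norm \<Lambda> N x \<le> B" if "\<And>n. s n \<in> l1_sum \<Lambda> E N" "x \<in> l1_sum \<Lambda> E N"
    "\<And>i. i \<in> \<Lambda> \<Longrightarrow> (\<lambda>n. N i (s n i - x i)) \<longlonglongrightarrow> 0" "\<And>n. l1_norm \<Lambda> N (s n) \<le> B" for s x B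
    using that(1) l1_sum_family[OF that(2)] that(3,4) by (rule l1_norm_lower_semicontinuous(2))
  fix s x assume s: "\<And>n::nat. s n \<in> l1_sum \<Lambda> E N" and Cauchy: "\<forall>\<epsilon>>0. \<exists>K. \<forall>m\<ge>K. \<forall>n\<ge>K. l1_norm \<Lambda> N (s m - s n) < \<epsilon>"
    and x: "x \<in> family_space \<Lambda> E" and lim: "\<And>i. i \<in> \<Lambda> \<Longrightarrow> (\<lambda>n. N i (s n i - x i)) \<longlonglongrightarrow> 0"
  \<comment> \<open>Any fixed tolerance works; it only bounds the norms of the tail by the norm of
    \<open>s K\<close> plus 1.\<close>
  obtain K where K: "\<forall>m\<ge>K. \<forall>n\<ge>K. l1_norm \<Lambda> N (s m - s n) < 1" using Cauchy zero_less_one by blast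
  show "x \<in> l1_sum \<Lambda> E N"
  proof (rule l1_norm_lower_semicontinuous(1)[of "\<lambda>n. s (n + K)", OF s x])
    show "(\<lambda>n. N i (s (n + K) i - x i)) \<longlonglongrightarrow> 0" if "i \<in> \<Lambda>" for i
      using lim[OF that] by (rule LIMSEQ_ignore_initial_segment)
    show "l1_norm \<Lambda> N (s (n + K)) \<le> l1_norm \<Lambda> N (s K) + 1" for n
      using S.norm_triangle_sub[OF s s, of "n + K" K] K[rule_format, of "n + K" K] by simp
  qed
qed

lemma l1_norm_split:
  assumes x: "x \<in> l1_sum \<Lambda> E N" and i: "i \<in> \<Lambda>"
  shows "x(i := 0) \<in> l1_sum \<Lambda> E N" "l1_norm \<Lambda> N x = N i (x i) + l1_norm \<Lambda> N (x(i := 0))"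
proof -
  note F = x[THEN l1_sum_family]
  have up: "x(i := 0) \<in> family_space \<Lambda> E" using fun_upd_family[OF F i] i by simp
  have le: "N j ((x(i := 0)) j) \<le> N j (x j)" if "j \<in> \<Lambda>" for j
    using family_norm_ge_0[OF F that] i by auto
  show mem: "x(i := 0) \<in> l1_sum \<Lambda> E N" using up l1_summable[OF x] le by (rule l1_sumI)
  have split: "infsum f \<Lambda> = f i + infsum f (\<Lambda> - {i})" if "f summable_on \<Lambda>" for f :: "'i \<Rightarrow> real"
    using infsum_Un_disjoint[of f "{i}" "\<Lambda> - {i}"] summable_on_subset_banach[OF that, of "\<Lambda> - {i}"] i
    by (simp add: insert_absorb)
  have "infsum (\<lambda>j. N j ((x(i := 0)) j)) (\<Lambda> - {i}) = infsum (\<lambda>j. N j (x j)) (\<Lambda> - {i})"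
    by (intro infsum_cong) auto
  then show "l1_norm \<Lambda> N x = N i (x i) + l1_norm \<Lambda> N (x(i := 0))"
    using split[OF l1_summable[OF x]] split[OF l1_summable[OF mem]] i by (simp add: l1_norm_def)
qed

lemma l1_norm_single:
  assumes i: "i \<in> \<Lambda>" and a: "a \<in> E i"
  shows "0(i := a) \<in> l1_sum \<Lambda> E N" "l1_norm \<Lambda> N (0(i := a)) = N i a"
proof -
  interpret S: normed_on "l1_sum \<Lambda> E N" "l1_norm \<Lambda> N" by unfold_locales (rule normed_l1_sum)
  have fam: "0(i := a) \<in> family_space \<Lambda> E"
    using subspace_0[OF subspace_family_space] i a by (rule fun_upd_family)
  show mem: "0(i := a) \<in> l1_sum \<Lambda> E N"
  proof (rule l1_sumI(1)[OF fam])
    show "(\<lambda>j. if j = i then N i a else 0) summable_on \<Lambda>"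
      using summable_on_cong_neutral[of "{i}" \<Lambda> "\<lambda>j. if j = i then N i a else 0" "\<lambda>j. if j = i then N i a else 0"] i
      by auto
  qed (use i in auto)
  have "(0(i := a))(i := 0) = (0 :: 'i \<Rightarrow> 'a)" by auto
  then show "l1_norm \<Lambda> N (0(i := a)) = N i a"
    using l1_norm_split(2)[OF mem i] by simp
qed

text \<open>Witnesses in the sum may carry masses \<open>b\<close> and \<open>c\<close> outside
  coordinate \<open>i\<close>, and these count fully in both inequalities. Dropping them would spoil
  the first; \<open>absorb_remainder\<close> moves them into coordinate \<open>i\<close> as
  multiples of \<open>x\<close>.\<close>

lemma metric_GL_l1_sumD:
  assumes GL: "metric_GL (l1_sum \<Lambda> E N) (l1_norm \<Lambda> N)" and i: "i \<in> \<Lambda>"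
  shows "metric_GL (E i) (N i)"
  unfolding metric_GL_def
proof (intro ballI allI impI)
  let ?S = "l1_sum \<Lambda> E N" and ?M = "l1_norm \<Lambda> N"
  interpret S: normed_on ?S ?M by unfold_locales (rule normed_l1_sum)
  interpret Ei: normed_on "E i" "N i" using i by (rule member)
  fix x y and \<epsilon> :: real assume "x \<in> unit_sphere_on (E i) (N i)" "y \<in> unit_sphere_on (E i) (N i)" and e: "\<epsilon> > 0"
  then have x: "x \<in> E i" "N i x = 1" and y: "y \<in> E i" "N i y = 1" by (auto simp: unit_sphere_on_def)
  note X = l1_norm_single[OF i x(1)] and Y = l1_norm_single[OF i y(1)]
  \<comment> \<open>\<open>absorb_remainder\<close> triples the error.\<close>
  have e3: "\<epsilon> / 3 > 0" using e by simp
  obtain z w where zw: "z \<in> ?S" "?M z \<le> 1" "w \<in> ?S" "?M w \<le> 1"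
    "?M (0(i := x) + z + w) > 3 - \<epsilon> / 3" "?M (0(i := y) - z) + ?M (0(i := y) + w) < 2 + \<epsilon> / 3"
    using metric_GLD[OF GL, of "0(i := x)" "0(i := y)" "\<epsilon> / 3"] X Y x y e3 by metis
  note zs = l1_norm_split[OF zw(1) i] and ws = l1_norm_split[OF zw(3) i]
  define b c where "b = ?M (z(i := 0))" and "c = ?M (w(i := 0))"
  have bc: "0 \<le> b" "0 \<le> c" using zs ws S.norm_ge_0 by (auto simp: b_def c_def)
  have zi: "z i \<in> E i" "w i \<in> E i" using zw l1_sum_family family_mem i by metis+
  have upd: "(0(i := x) + z + w)(i := 0) = z(i := 0) + w(i := 0)"
    "(0(i := y) - z)(i := 0) = - (z(i := 0))" "(0(i := y) + w)(i := 0) = w(i := 0)"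
    by auto
  have "?M (0(i := x) + z + w) = N i (x + z i + w i) + ?M (z(i := 0) + w(i := 0))"
    using l1_norm_split(2)[of "0(i := x) + z + w", OF _ i] X zw by (simp add: upd)
  then have sum: "N i (x + z i + w i) + b + c > 3 - \<epsilon> / 3"
    using zw(5) S.norm_triangle[OF zs(1) ws(1)] by (simp add: b_def c_def)
  have "?M (0(i := y) - z) = N i (y - z i) + b"
    using l1_norm_split(2)[of "0(i := y) - z", OF _ i] Y zw S.norm_minus[OF zs(1)] by (simp add: upd b_def)
  moreover have "?M (0(i := y) + w) = N i (y + w i) + c"
    using l1_norm_split(2)[of "0(i := y) + w", OF _ i] Y zw by (simp add: upd c_def)
  ultimately have diff: "N i (y - z i) + b + N i (y + w i) + c < 2 + \<epsilon> / 3"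
    using zw(6) by simp
  have "N i (z i) + b \<le> 1" "N i (w i) + c \<le> 1"
    using zs ws zw by (auto simp: b_def c_def)
  note ab = Ei.absorb_remainder[OF x y(1) zi bc(1) this(1) bc(2) this(2) e3 sum diff]
  have "z i + b *\<^sub>R x \<in> unit_ball_on (E i) (N i)" "w i + c *\<^sub>R x \<in> unit_ball_on (E i) (N i)"
    using ab(1,2) zi x by (auto simp: unit_ball_on_def)
  moreover have "N i (x + (z i + b *\<^sub>R x) + (w i + c *\<^sub>R x)) > 3 - \<epsilon>"
    using ab(3) by simp
  moreover have "N i (y - (z i + b *\<^sub>R x)) + N i (y + (w i + c *\<^sub>R x)) < 2 + \<epsilon>"
    using ab(4) e by simp
  ultimately show "\<exists>z\<in>unit_ball_on (E i) (N i). \<exists>w\<in>unit_ball_on (E i) (N i).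
      N i (x + z + w) > 3 - \<epsilon> \<and> N i (y - z) + N i (y + w) < 2 + \<epsilon>"
    by blast
qed

text \<open>Norms of the sum are sums of norms, so the homogeneous condition is applied in every
  coordinate and added up. The bounds of the chosen vectors by \<open>N i (y i)\<close> make the
  resulting families summable, of norm at most 1.\<close>

lemma metric_GL_l1_sumI:
  assumes GL: "\<And>i. i \<in> \<Lambda> \<Longrightarrow> metric_GL (E i) (N i)"
  shows "metric_GL (l1_sum \<Lambda> E N) (l1_norm \<Lambda> N)"
  unfolding metric_GL_def
proof (intro ballI allI impI)
  let ?S = "l1_sum \<Lambda> E N" and ?M = "l1_norm \<Lambda> N"
  interpret S: normed_on ?S ?M by unfold_locales (rule normed_l1_sum)
  fix x y and \<epsilon> :: real assume "x \<in> unit_sphere_on ?S ?M" "y \<in> unit_sphere_on ?S ?M" and e: "\<epsilon> > 0"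
  then have x: "x \<in> ?S" "?M x = 1" and y: "y \<in> ?S" "?M y = 1" by (auto simp: unit_sphere_on_def)
  \<comment> \<open>For unit vectors the summed lower bound is
    \<open>(1 - \<eta>) + (2 - \<eta>) = 3 - 2 * \<eta>\<close>, which must exceed
    \<open>3 - \<epsilon>\<close>.\<close>
  define \<eta> where "\<eta> = \<epsilon> / 3"
  have \<eta>: "\<eta> > 0" using e by (simp add: \<eta>_def)
  define P where "P i a b \<longleftrightarrow> a \<in> E i \<and> b \<in> E i \<and> N i a \<le> N i (y i) \<and> N i b \<le> N i (y i) \<and>
    N i (x i + a + b) \<ge> N i (x i) + 2 * N i (y i) - \<eta> * (N i (x i) + N i (y i)) \<and>
    N i (y i - a) + N i (y i + b) \<le> (2 + \<eta>) * N i (y i)" for i a b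
  have "\<exists>a b. P i a b" if i: "i \<in> \<Lambda>" for i
    unfolding P_def
    using normed_on.metric_GL_homogeneous[OF member[OF i] GL[OF i] family_mem[OF l1_sum_family[OF x(1)] i]
      family_mem[OF l1_sum_family[OF y(1)] i] \<eta>] .
  then obtain a b where ab: "\<And>i. i \<in> \<Lambda> \<Longrightarrow> P i (a i) (b i)" by metis
  define z w where "z = (\<lambda>i. if i \<in> \<Lambda> then a i else 0)" and "w = (\<lambda>i. if i \<in> \<Lambda> then b i else 0)"
  have P: "P i (z i) (w i)" if "i \<in> \<Lambda>" for i using ab[OF that] that by (simp add: z_def w_def)
  have fam: "z \<in> family_space \<Lambda> E" "w \<in> family_space \<Lambda> E"
    using ab by (auto simp: family_space_def z_def w_def P_def)
  have zw: "z \<in> ?S" "w \<in> ?S" "?M z \<le> 1" "?M w \<le> 1"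
    using l1_sumI[OF fam(1) l1_summable[OF y(1)]] l1_sumI[OF fam(2) l1_summable[OF y(1)]] P y(2)
    by (auto simp: P_def l1_norm_def)
  note summable = l1_summable[OF x(1)] l1_summable[OF y(1)]
  have "((\<lambda>i. (1 - \<eta>) * N i (x i) + (2 - \<eta>) * N i (y i)) has_sum (1 - \<eta>) * ?M x + (2 - \<eta>) * ?M y) \<Lambda>"
    unfolding l1_norm_def by (intro has_sum_add has_sum_cmult_right has_sum_infsum summable)
  moreover have "((\<lambda>i. N i ((x + z + w) i)) has_sum ?M (x + z + w)) \<Lambda>"
    unfolding l1_norm_def by (intro has_sum_infsum l1_summable S.mem x zw)
  ultimately have "(1 - \<eta>) * ?M x + (2 - \<eta>) * ?M y \<le> ?M (x + z + w)"
    by (rule has_sum_mono) (use P in \<open>auto simp: P_def algebra_simps\<close>)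
  then have lower: "?M (x + z + w) > 3 - \<epsilon>" using x y e by (simp add: \<eta>_def)
  have upper: "((\<lambda>i. (2 + \<eta>) * N i (y i)) has_sum (2 + \<eta>) * ?M y) \<Lambda>"
    unfolding l1_norm_def by (intro has_sum_cmult_right has_sum_infsum summable)
  have "((\<lambda>i. N i ((y - z) i) + N i ((y + w) i)) has_sum ?M (y - z) + ?M (y + w)) \<Lambda>"
    unfolding l1_norm_def by (intro has_sum_add has_sum_infsum l1_summable S.mem y zw)
  then have "?M (y - z) + ?M (y + w) \<le> (2 + \<eta>) * ?M y"
    using upper by (rule has_sum_mono) (use P in \<open>auto simp: P_def\<close>)
  then have "?M (y - z) + ?M (y + w) < 2 + \<epsilon>"
    using y e by (simp add: \<eta>_def)
  with lower show "\<exists>z\<in>unit_ball_on ?S ?M. \<exists>w\<in>unit_ball_on ?S ?M. ?M (x + z + w) > 3 - \<epsilon> \<and> ?M (y - z) + ?M (y + w) < 2 + \<epsilon>"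
    using zw unfolding unit_ball_on_def by blast
qed

end

theorem proposition3p13:
  fixes \<Lambda> :: "'i set"
    and E :: "'i \<Rightarrow> 'a::real_vector set"
    and N :: "'i \<Rightarrow> 'a \<Rightarrow> real"
  assumes "\<And>l. l \<in> \<Lambda> \<Longrightarrow> banach_space_on (E l) (N l)"
  shows "(local_GL_space (c0_sum \<Lambda> E N) (c0_norm \<Lambda> N) \<longleftrightarrow>
            (\<forall>l\<in>\<Lambda>. local_GL_space (E l) (N l))) \<and>
         (local_GL_space (l1_sum \<Lambda> E N) (l1_norm \<Lambda> N) \<longleftrightarrow>
            (\<forall>l\<in>\<Lambda>. local_GL_space (E l) (N l)))"
proof -
  interpret banach_family \<Lambda> E N by unfold_locales (rule assms)
  have "(\<forall>l\<in>\<Lambda>. local_GL_space (E l) (N l)) \<longleftrightarrow> (\<forall>l\<in>\<Lambda>. metric_GL (E l) (N l))"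
    using normed_on.local_GL_space_iff_metric_GL[OF member banach] by simp
  moreover have "local_GL_space (c0_sum \<Lambda> E N) (c0_norm \<Lambda> N) \<longleftrightarrow> (\<forall>l\<in>\<Lambda>. metric_GL (E l) (N l))"
    using normed_on.local_GL_space_iff_metric_GL[OF normed_on.intro[OF normed_c0_sum] banach_c0_sum]
      metric_GL_c0_sumI metric_GL_c0_sumD by blast
  moreover have "local_GL_space (l1_sum \<Lambda> E N) (l1_norm \<Lambda> N) \<longleftrightarrow> (\<forall>l\<in>\<Lambda>. metric_GL (E l) (N l))"
    using normed_on.local_GL_space_iff_metric_GL[OF normed_on.intro[OF normed_l1_sum] banach_l1_sum]
      metric_GL_l1_sumI metric_GL_l1_sumD by blast
  ultimately show ?thesis by simp
qed

end
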